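(* (Poincaré–Birkhoff–Witt for the integral form.) Let $\mathcal S$ be a root generating system, $\mathfrak g$ its Kac–Moody algebra and $\mathcal U$ the integral enveloping algebra. Let $\mathcal B=\bigcup_{\alpha\in\Delta\cup\{0\}}\mathcal B_\alpha$ be a $\mathbb Z$-basis of $\mathfrak g_{\mathbb Z}$ with $\mathcal B_\alpha$ a $\mathbb Z$-basis of $\mathfrak g_{\alpha\mathbb Z}$, chosen so that $\mathcal B_{\alpha_i}=\{e_i\}$, $\mathcal B_{-\alpha_i}=\{f_i\}$ for $i\in I$ and, for $\alpha\in\Phi^+$, $\mathcal B_\alpha=\{e_\alpha\}$, $\mathcal B_{-\alpha}=\{f_\alpha\}$ with $[e_\alpha,f_\alpha]=-\alpha^\vee$; order $\mathcal B$ totally in an arbitrary way. For each $x\in\mathcal B_\alpha$ choose elements $x^{[n]}\in\mathcal U_{n\alpha}$ ($n\in\mathbb N$) with $x^{[0]}=1$, $x^{[1]}=x$ and such that $x^{[n]}-x^n/n!$ has filtration $<n$ in $\mathcal U_{\mathbb C}(\mathfrak g)$. For $N=(N_x)_{x\in\mathcal B}\in\mathbb N^{(\mathcal B)}$ (finite support) put $[N]=\prod_{x\in\mathcal B}x^{[N_x]}$, the product being taken in the chosen order. Then the elements $[N]$, $N\in\mathbb N^{(\mathcal B)}$, form a basis of $\mathcal U$ over $\mathbb Z$.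
   Context: A Kac–Moody matrix is an integer matrix $A=(a_{i,j})_{i,j\in I}$, $I$ finite, with $a_{i,i}=2$, $a_{i,j}\le 0$ for $i\neq j$, $a_{i,j}=0\iff a_{j,i}=0$. A root generating system is $\mathcal S=(A,Y,(\overline{\alpha_i})_{i\in I},(\alpha_i^\vee)_{i\in I})$ with $Y$ a free $\mathbb Z$-module of finite rank, $\overline{\alpha_i}\in X=Y^*$, $\alpha_i^\vee\in Y$, $\overline{\alpha_j}(\alpha_i^\vee)=a_{i,j}$. $Q=\bigoplus_i\mathbb Z\alpha_i$ is free on symbols $\alpha_i$, mapped to $X$ by $\alpha_i\mapsto\overline{\alpha_i}$ (used to evaluate $\alpha\in Q$ on $\mathfrak h$). $\mathfrak g$ is the complex Lie algebra generated by $\mathfrak h=Y\otimes\mathbb C$, $e_i,f_i$ with relations $[h,h']=0$, $[h,e_i]=\alpha_i(h)e_i$, $[h,f_i]=-\alpha_i(h)f_i$, $[e_i,f_i]=-\alpha_i^\vee$, and for $i\ne j$: $[e_i,f_j]=0$, $(\mathrm{ad}\,e_i)^{1-a_{i,j}}e_j=(\mathrm{ad}\,f_i)^{1-a_{i,j}}f_j=0$. It is $Q$-graded: $\mathfrak g=\mathfrak h\oplus\bigoplus_{\alpha\in\Delta}\mathfrak g_\alpha$, $\mathfrak g_0=\mathfrak h$, $\Delta^\pm=\Delta\cap\pm\sum\mathbb N\alpha_i$. $W^v$ is generated by $s_i(\alpha)=\alpha-\alpha(\alpha_i^\vee)\alpha_i$ (and acts dually on $Y$); $\Phi=\bigcup_iW^v\alpha_i$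 is the set of real roots, $\Phi^+=\Phi\cap\Delta^+$, and $\alpha^\vee=w\alpha_i^\vee$ if $\alpha=w\alpha_i$. $\mathcal U$ is the $\mathbb Z$-subalgebra of the enveloping algebra $\mathcal U_{\mathbb C}(\mathfrak g)$ generated by $e_i^n/n!$, $f_i^n/n!$ ($i\in I$) and $\binom hn$ ($h\in Y$), $n\in\mathbb N$; it is $Q$-graded, $\mathcal U=\bigoplus_\alpha\mathcal U_\alpha$, and "filtration" means the standard filtration of $\mathcal U_{\mathbb C}(\mathfrak g)$. $\mathfrak g_{\mathbb Z}=\mathfrak g\cap\mathcal U$, $\mathfrak g_{\alpha\mathbb Z}=\mathfrak g_\alpha\cap\mathcal U$, $\mathfrak g_{0\mathbb Z}=Y$. Elements $x^{[n]}$ as in the claim always exist. *)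

theory Defs
  imports Complex_Main "HOL-Library.Poly_Mapping"
begin

section \<open>Abelian groups as modules over the integers\<close>

definition zmul :: "int \<Rightarrow> 'a::ab_group_add \<Rightarrow> 'a" where
  "zmul k x = (if 0 \<le> k then (((+) x) ^^ nat k) 0 else - ((((+) x) ^^ nat (- k)) 0))"

lemma zmul_of_nat: "zmul (int n) x = (((+) x) ^^ n) 0"
  by (simp add: zmul_def)

lemma zmul_minus: "zmul (- k) x = - zmul k x"
  by (cases "k = 0") (auto simp: zmul_def)

lemma zmul_succ: "zmul (k + 1) x = zmul k x + x"
proof (cases k rule: int_cases2)
  case (nonneg n)
  then have "zmul (k + 1) x = zmul (int (Suc n)) x"
    by (simp add: algebra_simps)
  then show ?thesis
    by (simp only: zmul_of_nat nonneg) (simp add: add.commute)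
next
  case (nonpos n)
  show ?thesis
  proof (cases n)
    case 0
    then show ?thesis using nonpos by (simp add: zmul_def)
  next
    case (Suc m)
    then have "k + 1 = - int m" "k = - int (Suc m)" using nonpos by simp_all
    then show ?thesis
      by (simp only: zmul_minus zmul_of_nat) simp
  qed
qed

lemma zmul_add_left: "zmul (k + l) x = zmul k x + zmul l x"
proof (induction l rule: int_induct[where k = 0])
  case base
  show ?case by (simp add: zmul_def)
next
  case (step1 i)
  have "zmul (k + (i + 1)) x = zmul ((k + i) + 1) x" by (simp add: add.assoc)
  with step1 show ?case using zmul_succ[of "k + i" x] zmul_succ[of i x]
    by (simp add: add.assoc)
next
  case (step2 i)
  have "zmul (k + i) x = zmul (k + (i - 1)) x + x" "zmul i x = zmul (i - 1) x + x"
    using zmul_succ[of "k + (i - 1)" x] zmul_succ[of "i - 1" x] by simp_all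
  with step2 show ?case by (simp add: algebra_simps)
qed

lemma zmul_add_right: "zmul k (x + y) = zmul k x + zmul k y"
proof -
  have *: "zmul (int n) (x + y) = zmul (int n) x + zmul (int n) y" for n
    unfolding zmul_of_nat by (induction n) (auto simp: algebra_simps)
  show ?thesis
    by (cases k rule: int_cases2) (auto simp: * zmul_minus)
qed

lemma zmul_assoc: "zmul k (zmul l x) = zmul (k * l) x"
proof (induction k rule: int_induct[where k = 0])
  case base
  show ?case by (simp add: zmul_def)
next
  case (step1 i)
  then show ?case
    using zmul_succ[of i "zmul l x"] zmul_add_left[of "i * l" l x]
    by (simp add: algebra_simps)
next
  case (step2 i)
  have "zmul i (zmul l x) = zmul (i - 1) (zmul l x) + zmul l x"
    using zmul_succ[of "i - 1" "zmul l x"] by simp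
  moreover have "zmul (i * l) x = zmul ((i - 1) * l) x + zmul l x"
    using zmul_add_left[of "(i - 1) * l" l x] by (simp add: algebra_simps)
  ultimately show ?case using step2 by simp
qed

interpretation zmod: module zmul
proof
  show "zmul 1 x = x" for x :: 'a
    using zmul_succ[of 0 x] by (simp add: zmul_def)
qed (simp_all add: zmul_add_left zmul_add_right zmul_assoc)

definition Z_basis :: "'a::ab_group_add set \<Rightarrow> 'a set \<Rightarrow> bool" where
  "Z_basis B M \<longleftrightarrow> \<not> zmod.dependent B \<and> zmod.span B = M"


section \<open>Root generating systems\<close>

text \<open>The finitely generated free abelian group \<open>Y\<close> is the whole type \<open>'y\<close>; \<open>I\<close> is a finite
  (possibly empty) subset of the type \<open>'i\<close>.\<close>

record ('i, 'y) root_data =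
  index :: "'i set"
  cartan :: "'i \<Rightarrow> 'i \<Rightarrow> int"
  sroot :: "'i \<Rightarrow> 'y \<Rightarrow> int"
  scoroot :: "'i \<Rightarrow> 'y"

definition kac_moody_matrix :: "'i set \<Rightarrow> ('i \<Rightarrow> 'i \<Rightarrow> int) \<Rightarrow> bool" where
  "kac_moody_matrix I A \<longleftrightarrow> finite I \<and> (\<forall>i\<in>I. A i i = 2) \<and>
     (\<forall>i\<in>I. \<forall>j\<in>I. i \<noteq> j \<longrightarrow> A i j \<le> 0) \<and>
     (\<forall>i\<in>I. \<forall>j\<in>I. A i j = 0 \<longleftrightarrow> A j i = 0)"

definition root_generating_system :: "('i, 'y::ab_group_add) root_data \<Rightarrow> bool" where
  "root_generating_system S \<longleftrightarrow>
     kac_moody_matrix (index S) (cartan S) \<and>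
     (\<exists>b :: 'y set. finite b \<and> Z_basis b UNIV) \<and>
     (\<forall>i\<in>index S. additive (sroot S i)) \<and>
     (\<forall>i\<in>index S. \<forall>j\<in>index S. sroot S j (scoroot S i) = cartan S i j)"

type_synonym 'i root_lattice = "'i \<Rightarrow>\<^sub>0 int"

abbreviation simple :: "'i \<Rightarrow> 'i root_lattice" where
  "simple i \<equiv> Poly_Mapping.single i 1"

definition root_eval :: "('i, 'y) root_data \<Rightarrow> 'i root_lattice \<Rightarrow> 'y \<Rightarrow> int" where
  "root_eval S \<alpha> y = (\<Sum>i\<in>Poly_Mapping.keys \<alpha>. Poly_Mapping.lookup \<alpha> i * sroot S i y)"

definition reflection :: "('i, 'y) root_data \<Rightarrow> 'i \<Rightarrow> 'i root_lattice \<Rightarrow> 'i root_lattice" where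
  "reflection S i \<alpha> = \<alpha> - zmul (root_eval S \<alpha> (scoroot S i)) (simple i)"

definition coreflection :: "('i, 'y::ab_group_add) root_data \<Rightarrow> 'i \<Rightarrow> 'y \<Rightarrow> 'y" where
  "coreflection S i y = y - zmul (sroot S i y) (scoroot S i)"

text \<open>An element of the Weyl group is given by its action on \<open>Q\<close> together with the dual action
  on \<open>Y\<close>. The generators are involutions, so no closure under inverses is needed.\<close>

inductive_set weyl_group ::
    "('i, 'y::ab_group_add) root_data
      \<Rightarrow> (('i root_lattice \<Rightarrow> 'i root_lattice) \<times> ('y \<Rightarrow> 'y)) set"
  for S :: "('i, 'y::ab_group_add) root_data"
where
  weyl_id: "(id, id) \<in> weyl_group S"
| weyl_step: "(w, v) \<in> weyl_group S \<Longrightarrow> i \<in> index S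
    \<Longrightarrow> (reflection S i \<circ> w, coreflection S i \<circ> v) \<in> weyl_group S"

definition real_roots :: "('i, 'y::ab_group_add) root_data \<Rightarrow> 'i root_lattice set" where
  "real_roots S = {w (simple i) | w v i. (w, v) \<in> weyl_group S \<and> i \<in> index S}"

definition real_coroot :: "('i, 'y::ab_group_add) root_data \<Rightarrow> 'i root_lattice \<Rightarrow> 'y" where
  "real_coroot S \<alpha> = (THE y. \<exists>w v i. (w, v) \<in> weyl_group S \<and> i \<in> index S \<and>
     \<alpha> = w (simple i) \<and> y = v (scoroot S i))"


section \<open>Complex Lie algebras given by generators and relations\<close>

locale complex_lie_algebra = vector_space scale
  for scale :: "complex \<Rightarrow> 'g::ab_group_add \<Rightarrow> 'g" +
  fixes bracket :: "'g \<Rightarrow> 'g \<Rightarrow> 'g"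
  assumes bracket_add_left: "bracket (x + y) z = bracket x z + bracket y z"
    and bracket_add_right: "bracket x (y + z) = bracket x y + bracket x z"
    and bracket_scale_left: "bracket (scale c x) y = scale c (bracket x y)"
    and bracket_scale_right: "bracket x (scale c y) = scale c (bracket x y)"
    and bracket_self: "bracket x x = 0"
    and jacobi: "bracket x (bracket y z) + bracket y (bracket z x) + bracket z (bracket x y) = 0"

datatype 'x lie_term =
    LGen 'x
  | LZero
  | LAdd "'x lie_term" "'x lie_term"
  | LScale complex "'x lie_term"
  | LBracket "'x lie_term" "'x lie_term"

text \<open>The least congruence on terms containing \<open>R\<close> and all instances of the axioms of complex Lie
  algebras: the quotient by it is the Lie algebra with the relations \<open>R\<close>.\<close>

inductive lie_cong ::
    "('x lie_term \<Rightarrow> 'x lie_term \<Rightarrow> bool) \<Rightarrow> 'x lie_term \<Rightarrow> 'x lie_term \<Rightarrow> bool"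
  for R :: "'x lie_term \<Rightarrow> 'x lie_term \<Rightarrow> bool"
where
  "R s t \<Longrightarrow> lie_cong R s t"
| "lie_cong R t t"
| "lie_cong R s t \<Longrightarrow> lie_cong R t s"
| "lie_cong R s t \<Longrightarrow> lie_cong R t u \<Longrightarrow> lie_cong R s u"
| "lie_cong R s s' \<Longrightarrow> lie_cong R t t' \<Longrightarrow> lie_cong R (LAdd s t) (LAdd s' t')"
| "lie_cong R t t' \<Longrightarrow> lie_cong R (LScale c t) (LScale c t')"
| "lie_cong R s s' \<Longrightarrow> lie_cong R t t' \<Longrightarrow> lie_cong R (LBracket s t) (LBracket s' t')"
| "lie_cong R (LAdd (LAdd s t) u) (LAdd s (LAdd t u))"
| "lie_cong R (LAdd s t) (LAdd t s)"
| "lie_cong R (LAdd LZero t) t"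
| "lie_cong R (LAdd t (LScale (- 1) t)) LZero"
| "lie_cong R (LScale c (LAdd s t)) (LAdd (LScale c s) (LScale c t))"
| "lie_cong R (LScale (c + d) t) (LAdd (LScale c t) (LScale d t))"
| "lie_cong R (LScale c (LScale d t)) (LScale (c * d) t)"
| "lie_cong R (LScale 1 t) t"
| "lie_cong R (LBracket (LAdd s t) u) (LAdd (LBracket s u) (LBracket t u))"
| "lie_cong R (LBracket s (LAdd t u)) (LAdd (LBracket s t) (LBracket s u))"
| "lie_cong R (LBracket (LScale c s) t) (LScale c (LBracket s t))"
| "lie_cong R (LBracket s (LScale c t)) (LScale c (LBracket s t))"
| "lie_cong R (LBracket t t) LZero"
| "lie_cong R (LAdd (LAdd (LBracket s (LBracket t u)) (LBracket t (LBracket u s)))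
    (LBracket u (LBracket s t))) LZero"

primrec lie_eval ::
    "(complex \<Rightarrow> 'g \<Rightarrow> 'g) \<Rightarrow> ('g \<Rightarrow> 'g \<Rightarrow> 'g) \<Rightarrow> ('x \<Rightarrow> 'g) \<Rightarrow> 'x lie_term \<Rightarrow> 'g::ab_group_add"
where
  "lie_eval sc br \<gamma> (LGen x) = \<gamma> x"
| "lie_eval sc br \<gamma> LZero = 0"
| "lie_eval sc br \<gamma> (LAdd s t) = lie_eval sc br \<gamma> s + lie_eval sc br \<gamma> t"
| "lie_eval sc br \<gamma> (LScale c t) = sc c (lie_eval sc br \<gamma> t)"
| "lie_eval sc br \<gamma> (LBracket s t) = br (lie_eval sc br \<gamma> s) (lie_eval sc br \<gamma> t)"

text \<open>The Lie algebra on the type \<open>'g\<close>, with the images \<open>\<gamma> x\<close> of the generators \<open>x \<in> X\<close>, is the one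
  generated by \<open>X\<close> with the relations \<open>R\<close> (which must only involve generators from \<open>X\<close>).\<close>

definition lie_presentation ::
    "(complex \<Rightarrow> 'g \<Rightarrow> 'g) \<Rightarrow> ('g \<Rightarrow> 'g \<Rightarrow> 'g::ab_group_add) \<Rightarrow> 'x set
      \<Rightarrow> ('x lie_term \<Rightarrow> 'x lie_term \<Rightarrow> bool) \<Rightarrow> ('x \<Rightarrow> 'g) \<Rightarrow> bool"
where
  "lie_presentation sc br X R \<gamma> \<longleftrightarrow>
     complex_lie_algebra sc br \<and>
     (\<forall>x. \<exists>t. set_lie_term t \<subseteq> X \<and> lie_eval sc br \<gamma> t = x) \<and>
     (\<forall>s t. set_lie_term s \<subseteq> X \<longrightarrow> set_lie_term t \<subseteq> X \<longrightarrow>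
        (lie_eval sc br \<gamma> s = lie_eval sc br \<gamma> t \<longleftrightarrow> lie_cong R s t))"


section \<open>Kac--Moody algebras\<close>

datatype ('i, 'y) km_gen = GenE 'i | GenF 'i | GenH 'y

text \<open>The first relation makes the subspace spanned by the generators \<open>GenH y\<close> a quotient of
  \<open>\<hh> = Y \<otimes> \<complex>\<close>; the remaining ones are stated for \<open>h \<in> Y\<close> and extend to \<open>\<hh>\<close> by linearity.\<close>

inductive km_rel ::
    "('i, 'y::ab_group_add) root_data
      \<Rightarrow> ('i, 'y) km_gen lie_term \<Rightarrow> ('i, 'y) km_gen lie_term \<Rightarrow> bool"
  for S :: "('i, 'y::ab_group_add) root_data"
where
  "km_rel S (LGen (GenH (y + y'))) (LAdd (LGen (GenH y)) (LGen (GenH y')))"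
| "km_rel S (LBracket (LGen (GenH y)) (LGen (GenH y'))) LZero"
| "i \<in> index S \<Longrightarrow> km_rel S (LBracket (LGen (GenH y)) (LGen (GenE i)))
    (LScale (of_int (sroot S i y)) (LGen (GenE i)))"
| "i \<in> index S \<Longrightarrow> km_rel S (LBracket (LGen (GenH y)) (LGen (GenF i)))
    (LScale (- of_int (sroot S i y)) (LGen (GenF i)))"
| "i \<in> index S \<Longrightarrow> km_rel S (LBracket (LGen (GenE i)) (LGen (GenF i)))
    (LScale (- 1) (LGen (GenH (scoroot S i))))"
| "i \<in> index S \<Longrightarrow> j \<in> index S \<Longrightarrow> i \<noteq> j
    \<Longrightarrow> km_rel S (LBracket (LGen (GenE i)) (LGen (GenF j))) LZero"
| "i \<in> index S \<Longrightarrow> j \<in> index S \<Longrightarrow> i \<noteq> j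
    \<Longrightarrow> km_rel S ((LBracket (LGen (GenE i)) ^^ nat (1 - cartan S i j)) (LGen (GenE j))) LZero"
| "i \<in> index S \<Longrightarrow> j \<in> index S \<Longrightarrow> i \<noteq> j
    \<Longrightarrow> km_rel S ((LBracket (LGen (GenF i)) ^^ nat (1 - cartan S i j)) (LGen (GenF j))) LZero"

record ('i, 'y, 'g) km_data =
  lscale :: "complex \<Rightarrow> 'g \<Rightarrow> 'g"
  lbracket :: "'g \<Rightarrow> 'g \<Rightarrow> 'g"
  gen_e :: "'i \<Rightarrow> 'g"
  gen_f :: "'i \<Rightarrow> 'g"
  gen_h :: "'y \<Rightarrow> 'g"

definition kac_moody_algebra ::
    "('i, 'y::ab_group_add) root_data \<Rightarrow> ('i, 'y, 'g::ab_group_add) km_data \<Rightarrow> bool" where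
  "kac_moody_algebra S G \<longleftrightarrow>
     lie_presentation (lscale G) (lbracket G)
       (GenE ` index S \<union> GenF ` index S \<union> range GenH) (km_rel S)
       (case_km_gen (gen_e G) (gen_f G) (gen_h G))"

text \<open>The \<open>Q\<close>-grading of the Kac--Moody algebra, with \<open>e\<^sub>i\<close>, \<open>f\<^sub>i\<close> and \<open>h\<close> of degree
  \<open>\<alpha>\<^sub>i\<close>, \<open>- \<alpha>\<^sub>i\<close> and \<open>0\<close>. As the images of the \<open>\<alpha>\<^sub>i\<close> in \<open>X\<close> need not be linearly
  independent, its components are in general not the weight spaces of \<open>\<hh>\<close>.\<close>

inductive homogeneous ::
    "('i, 'y) root_data \<Rightarrow> ('i, 'y, 'g::ab_group_add) km_data \<Rightarrow> 'i root_lattice \<Rightarrow> 'g \<Rightarrow> bool"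
  for S :: "('i, 'y) root_data" and G :: "('i, 'y, 'g::ab_group_add) km_data"
where
  "homogeneous S G 0 (gen_h G y)"
| "i \<in> index S \<Longrightarrow> homogeneous S G (simple i) (gen_e G i)"
| "i \<in> index S \<Longrightarrow> homogeneous S G (- simple i) (gen_f G i)"
| "homogeneous S G \<alpha> 0"
| "homogeneous S G \<alpha> x \<Longrightarrow> homogeneous S G \<alpha> y \<Longrightarrow> homogeneous S G \<alpha> (x + y)"
| "homogeneous S G \<alpha> x \<Longrightarrow> homogeneous S G \<alpha> (lscale G c x)"
| "homogeneous S G \<alpha> x \<Longrightarrow> homogeneous S G \<beta> y \<Longrightarrow> homogeneous S G (\<alpha> + \<beta>) (lbracket G x y)"

definition root_space ::
    "('i, 'y) root_data \<Rightarrow> ('i, 'y, 'g::ab_group_add) km_data \<Rightarrow> 'i root_lattice \<Rightarrow> 'g set" where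
  "root_space S G \<alpha> = {x. homogeneous S G \<alpha> x}"

definition roots ::
    "('i, 'y) root_data \<Rightarrow> ('i, 'y, 'g::ab_group_add) km_data \<Rightarrow> 'i root_lattice set" where
  "roots S G = {\<alpha>. \<alpha> \<noteq> 0 \<and> root_space S G \<alpha> \<noteq> {0}}"

definition positive_roots ::
    "('i, 'y) root_data \<Rightarrow> ('i, 'y, 'g::ab_group_add) km_data \<Rightarrow> 'i root_lattice set" where
  "positive_roots S G = {\<alpha> \<in> roots S G. \<forall>i. 0 \<le> Poly_Mapping.lookup \<alpha> i}"


section \<open>The enveloping algebra\<close>

locale complex_algebra = vector_space scale
  for scale :: "complex \<Rightarrow> 'u::ring_1 \<Rightarrow> 'u" +
  assumes scale_mult_left: "scale c x * y = scale c (x * y)"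
    and scale_mult_right: "x * scale c y = scale c (x * y)"

datatype 'x alg_term =
    AGen 'x
  | AZero
  | AOne
  | AAdd "'x alg_term" "'x alg_term"
  | AScale complex "'x alg_term"
  | AMult "'x alg_term" "'x alg_term"

text \<open>The least congruence containing all instances of the axioms of unital associative complex
  algebras and the relations expressing that the generators \<open>AGen x\<close>, \<open>x\<close> in the Lie algebra,
  depend linearly on \<open>x\<close> and satisfy \<open>x * y - y * x = [x, y]\<close>. The quotient by it is the tensor
  algebra modulo the usual ideal.\<close>

inductive env_cong ::
    "(complex \<Rightarrow> 'g \<Rightarrow> 'g::ab_group_add) \<Rightarrow> ('g \<Rightarrow> 'g \<Rightarrow> 'g)
      \<Rightarrow> 'g alg_term \<Rightarrow> 'g alg_term \<Rightarrow> bool"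
  for sc :: "complex \<Rightarrow> 'g \<Rightarrow> 'g::ab_group_add" and br :: "'g \<Rightarrow> 'g \<Rightarrow> 'g"
where
  "env_cong sc br (AGen (x + y)) (AAdd (AGen x) (AGen y))"
| "env_cong sc br (AGen (sc c x)) (AScale c (AGen x))"
| "env_cong sc br (AGen (br x y))
    (AAdd (AMult (AGen x) (AGen y)) (AScale (- 1) (AMult (AGen y) (AGen x))))"
| "env_cong sc br t t"
| "env_cong sc br s t \<Longrightarrow> env_cong sc br t s"
| "env_cong sc br s t \<Longrightarrow> env_cong sc br t u \<Longrightarrow> env_cong sc br s u"
| "env_cong sc br s s' \<Longrightarrow> env_cong sc br t t' \<Longrightarrow> env_cong sc br (AAdd s t) (AAdd s' t')"
| "env_cong sc br t t' \<Longrightarrow> env_cong sc br (AScale c t) (AScale c t')"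
| "env_cong sc br s s' \<Longrightarrow> env_cong sc br t t' \<Longrightarrow> env_cong sc br (AMult s t) (AMult s' t')"
| "env_cong sc br (AAdd (AAdd s t) u) (AAdd s (AAdd t u))"
| "env_cong sc br (AAdd s t) (AAdd t s)"
| "env_cong sc br (AAdd AZero t) t"
| "env_cong sc br (AAdd t (AScale (- 1) t)) AZero"
| "env_cong sc br (AScale c (AAdd s t)) (AAdd (AScale c s) (AScale c t))"
| "env_cong sc br (AScale (c + d) t) (AAdd (AScale c t) (AScale d t))"
| "env_cong sc br (AScale c (AScale d t)) (AScale (c * d) t)"
| "env_cong sc br (AScale 1 t) t"
| "env_cong sc br (AMult (AMult s t) u) (AMult s (AMult t u))"
| "env_cong sc br (AMult AOne t) t"
| "env_cong sc br (AMult t AOne) t"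
| "env_cong sc br (AMult (AAdd s t) u) (AAdd (AMult s u) (AMult t u))"
| "env_cong sc br (AMult s (AAdd t u)) (AAdd (AMult s t) (AMult s u))"
| "env_cong sc br (AMult (AScale c s) t) (AScale c (AMult s t))"
| "env_cong sc br (AMult s (AScale c t)) (AScale c (AMult s t))"

primrec alg_eval ::
    "(complex \<Rightarrow> 'u \<Rightarrow> 'u) \<Rightarrow> ('x \<Rightarrow> 'u) \<Rightarrow> 'x alg_term \<Rightarrow> 'u::ring_1"
where
  "alg_eval sc \<gamma> (AGen x) = \<gamma> x"
| "alg_eval sc \<gamma> AZero = 0"
| "alg_eval sc \<gamma> AOne = 1"
| "alg_eval sc \<gamma> (AAdd s t) = alg_eval sc \<gamma> s + alg_eval sc \<gamma> t"
| "alg_eval sc \<gamma> (AScale c t) = sc c (alg_eval sc \<gamma> t)"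
| "alg_eval sc \<gamma> (AMult s t) = alg_eval sc \<gamma> s * alg_eval sc \<gamma> t"

record ('g, 'u) env_data =
  ascale :: "complex \<Rightarrow> 'u \<Rightarrow> 'u"
  incl :: "'g \<Rightarrow> 'u"

text \<open>The algebra on the type \<open>'u\<close> together with \<open>incl\<close> is the universal enveloping algebra of the
  Lie algebra on \<open>'g\<close>.\<close>

definition enveloping_algebra ::
    "('i, 'y, 'g::ab_group_add) km_data \<Rightarrow> ('g, 'u::ring_1) env_data \<Rightarrow> bool" where
  "enveloping_algebra G U \<longleftrightarrow>
     complex_algebra (ascale U) \<and>
     (\<forall>u. \<exists>t. alg_eval (ascale U) (incl U) t = u) \<and>
     (\<forall>s t. alg_eval (ascale U) (incl U) s = alg_eval (ascale U) (incl U) t \<longleftrightarrow>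
        env_cong (lscale G) (lbracket G) s t)"

text \<open>The elements of filtration less than \<open>n\<close> for the standard filtration, i.e. the linear
  combinations of products of fewer than \<open>n\<close> elements of the Lie algebra (only \<open>0\<close> for \<open>n = 0\<close>).\<close>

definition filtration_less :: "('g, 'u::ring_1) env_data \<Rightarrow> nat \<Rightarrow> 'u set" where
  "filtration_less U n = module.span (ascale U) {prod_list (map (incl U) xs) | xs. length xs < n}"

inductive env_homogeneous ::
    "('i, 'y) root_data \<Rightarrow> ('i, 'y, 'g::ab_group_add) km_data \<Rightarrow> ('g, 'u::ring_1) env_data
      \<Rightarrow> 'i root_lattice \<Rightarrow> 'u \<Rightarrow> bool"
  for S :: "('i, 'y) root_data" and G :: "('i, 'y, 'g::ab_group_add) km_data"
    and U :: "('g, 'u::ring_1) env_data"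
where
  "env_homogeneous S G U 0 1"
| "x \<in> root_space S G \<alpha> \<Longrightarrow> env_homogeneous S G U \<alpha> (incl U x)"
| "env_homogeneous S G U \<alpha> 0"
| "env_homogeneous S G U \<alpha> u \<Longrightarrow> env_homogeneous S G U \<alpha> v \<Longrightarrow> env_homogeneous S G U \<alpha> (u + v)"
| "env_homogeneous S G U \<alpha> u \<Longrightarrow> env_homogeneous S G U \<alpha> (ascale U c u)"
| "env_homogeneous S G U \<alpha> u \<Longrightarrow> env_homogeneous S G U \<beta> v
    \<Longrightarrow> env_homogeneous S G U (\<alpha> + \<beta>) (u * v)"


section \<open>The integral enveloping algebra\<close>

definition divpow :: "('g, 'u::ring_1) env_data \<Rightarrow> 'u \<Rightarrow> nat \<Rightarrow> 'u" where
  "divpow U u n = ascale U (1 / fact n) (u ^ n)"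

definition env_binomial :: "('g, 'u::ring_1) env_data \<Rightarrow> 'u \<Rightarrow> nat \<Rightarrow> 'u" where
  "env_binomial U u n = ascale U (1 / fact n) (prod_list (map (\<lambda>k. u - of_nat k) [0..<n]))"

inductive_set int_env ::
    "('i, 'y) root_data \<Rightarrow> ('i, 'y, 'g) km_data \<Rightarrow> ('g, 'u::ring_1) env_data \<Rightarrow> 'u set"
  for S :: "('i, 'y) root_data" and G :: "('i, 'y, 'g) km_data"
    and U :: "('g, 'u::ring_1) env_data"
where
  "i \<in> index S \<Longrightarrow> divpow U (incl U (gen_e G i)) n \<in> int_env S G U"
| "i \<in> index S \<Longrightarrow> divpow U (incl U (gen_f G i)) n \<in> int_env S G U"
| "env_binomial U (incl U (gen_h G y)) n \<in> int_env S G U"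
| "1 \<in> int_env S G U"
| "u \<in> int_env S G U \<Longrightarrow> v \<in> int_env S G U \<Longrightarrow> u - v \<in> int_env S G U"
| "u \<in> int_env S G U \<Longrightarrow> v \<in> int_env S G U \<Longrightarrow> u * v \<in> int_env S G U"

definition int_env_degree ::
    "('i, 'y) root_data \<Rightarrow> ('i, 'y, 'g::ab_group_add) km_data \<Rightarrow> ('g, 'u::ring_1) env_data
      \<Rightarrow> 'i root_lattice \<Rightarrow> 'u set" where
  "int_env_degree S G U \<alpha> = {u \<in> int_env S G U. env_homogeneous S G U \<alpha> u}"

definition int_lie ::
    "('i, 'y) root_data \<Rightarrow> ('i, 'y, 'g) km_data \<Rightarrow> ('g, 'u::ring_1) env_data \<Rightarrow> 'g set" where
  "int_lie S G U = {x. incl U x \<in> int_env S G U}"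

text \<open>In degree \<open>0\<close> this is the image of \<open>Y\<close>.\<close>

definition int_root_space ::
    "('i, 'y) root_data \<Rightarrow> ('i, 'y, 'g::ab_group_add) km_data \<Rightarrow> ('g, 'u::ring_1) env_data
      \<Rightarrow> 'i root_lattice \<Rightarrow> 'g set" where
  "int_root_space S G U \<alpha> =
     (if \<alpha> = 0 then range (gen_h G) else root_space S G \<alpha> \<inter> int_lie S G U)"


section \<open>Bases and ordered monomials\<close>

definition adapted_basis ::
    "('i, 'y::ab_group_add) root_data \<Rightarrow> ('i, 'y, 'g::ab_group_add) km_data
      \<Rightarrow> ('g, 'u::ring_1) env_data \<Rightarrow> ('i root_lattice \<Rightarrow> 'g set) \<Rightarrow> 'g set \<Rightarrow> bool" where
  "adapted_basis S G U b B \<longleftrightarrow>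
     B = (\<Union>\<alpha>\<in>roots S G \<union> {0}. b \<alpha>) \<and>
     Z_basis B (int_lie S G U) \<and>
     (\<forall>\<alpha>\<in>roots S G \<union> {0}. Z_basis (b \<alpha>) (int_root_space S G U \<alpha>)) \<and>
     (\<forall>i\<in>index S. b (simple i) = {gen_e G i} \<and> b (- simple i) = {gen_f G i}) \<and>
     (\<forall>\<alpha>\<in>real_roots S \<inter> positive_roots S G. \<exists>e f. b \<alpha> = {e} \<and> b (- \<alpha>) = {f} \<and>
        lbracket G e f = - gen_h G (real_coroot S \<alpha>))"

definition divided_powers ::
    "('i, 'y) root_data \<Rightarrow> ('i, 'y, 'g::ab_group_add) km_data \<Rightarrow> ('g, 'u::ring_1) env_data
      \<Rightarrow> ('i root_lattice \<Rightarrow> 'g set) \<Rightarrow> ('g \<Rightarrow> nat \<Rightarrow> 'u) \<Rightarrow> bool" where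
  "divided_powers S G U b d \<longleftrightarrow>
     (\<forall>\<alpha>\<in>roots S G \<union> {0}. \<forall>x\<in>b \<alpha>.
        d x 0 = 1 \<and> d x 1 = incl U x \<and>
        (\<forall>n. d x n \<in> int_env_degree S G U (zmul (int n) \<alpha>) \<and>
             d x n - divpow U (incl U x) n \<in> filtration_less U n))"

text \<open>The list of the elements of a finite set \<open>X\<close>, increasing for the order relation \<open>r\<close>.\<close>

definition ordered_list :: "('a \<times> 'a) set \<Rightarrow> 'a set \<Rightarrow> 'a list" where
  "ordered_list r X = (THE xs. distinct xs \<and> set xs = X \<and> sorted_wrt (\<lambda>x y. (x, y) \<in> r) xs)"

definition monomial ::
    "('g \<times> 'g) set \<Rightarrow> ('g \<Rightarrow> nat \<Rightarrow> 'u::monoid_mult) \<Rightarrow> ('g \<Rightarrow>\<^sub>0 nat) \<Rightarrow> 'u" where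
  "monomial r d N =
     prod_list (map (\<lambda>x. d x (Poly_Mapping.lookup N x)) (ordered_list r (Poly_Mapping.keys N)))"

end

theory Submission
  imports Defs "HOL-Library.Function_Algebras" "HOL-Library.Multiset"
begin

text \<open>For functionals \<open>l\<^sub>1, \<dots>, l\<^sub>n\<close> on the enveloping algebra that vanish at \<open>1\<close>, the convolution
  \<open>l\<^sub>1 * \<cdots> * l\<^sub>n\<close>, taken with respect to the coproduct, vanishes in filtration less than \<open>n\<close> and maps a
  product \<open>x\<^sub>1 \<cdots> x\<^sub>n\<close> of Lie algebra elements to the permanent of \<open>(l\<^sub>i x\<^sub>j)\<close>. If the \<open>l\<^sub>i\<close> are dual
  to basis elements, it therefore reads off the coefficient of \<open>[N]\<close> in the leading term, and this gives the
  independence of the \<open>[N]\<close>. As \<open>\<U>\<close> is closed under the coproduct, the leading coefficients of an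
  element of \<open>\<U>\<close> are integers if the \<open>l\<^sub>i\<close> are integral on the finitely many elements of \<open>\<U>\<close>
  that occur in its iterated coproduct; then the \<open>[N]\<close> generate \<open>\<U>\<close>, by induction on the filtration.

  Dual functionals that are integral on finitely many given elements exist because the Lie elements are a pure
  subgroup of \<open>\<U>\<close>; they are additive at first, and become linear because the defining relations of the
  Kac--Moody algebra are integral.\<close>

section \<open>Modules from generators and relations\<close>

text \<open>The action is defined on terms because a presentation gives access to the algebra only
  through congruence of terms; \<open>lie_act_cong\<close> lets it descend.\<close>

primrec lie_act ::
    "(complex \<Rightarrow> 'v \<Rightarrow> 'v) \<Rightarrow> ('x \<Rightarrow> 'v \<Rightarrow> 'v) \<Rightarrow> 'x lie_term \<Rightarrow> 'v \<Rightarrow> 'v::ab_group_add"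
where
  "lie_act sv \<gamma> (LGen x) v = \<gamma> x v"
| "lie_act sv \<gamma> LZero v = 0"
| "lie_act sv \<gamma> (LAdd s t) v = lie_act sv \<gamma> s v + lie_act sv \<gamma> t v"
| "lie_act sv \<gamma> (LScale c t) v = sv c (lie_act sv \<gamma> t v)"
| "lie_act sv \<gamma> (LBracket s t) v =
    lie_act sv \<gamma> s (lie_act sv \<gamma> t v) - lie_act sv \<gamma> t (lie_act sv \<gamma> s v)"

primrec alg_act ::
    "(complex \<Rightarrow> 'v \<Rightarrow> 'v) \<Rightarrow> ('x \<Rightarrow> 'v \<Rightarrow> 'v) \<Rightarrow> 'x alg_term \<Rightarrow> 'v \<Rightarrow> 'v::ab_group_add"
where
  "alg_act sv \<gamma> (AGen x) v = \<gamma> x v"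
| "alg_act sv \<gamma> AZero v = 0"
| "alg_act sv \<gamma> AOne v = v"
| "alg_act sv \<gamma> (AAdd s t) v = alg_act sv \<gamma> s v + alg_act sv \<gamma> t v"
| "alg_act sv \<gamma> (AScale c t) v = sv c (alg_act sv \<gamma> t v)"
| "alg_act sv \<gamma> (AMult s t) v = alg_act sv \<gamma> s (alg_act sv \<gamma> t v)"

text \<open>The operators are only required to be linear on a subspace \<open>V\<close>: below, \<open>V\<close> consists of the
  additive or bilinear functions among all functions.\<close>

locale operator_space = vector_space sv
  for sv :: "complex \<Rightarrow> 'v::ab_group_add \<Rightarrow> 'v" +
  fixes V :: "'v set"
  assumes subspace_V: "subspace V"
begin

definition lin_op :: "('v \<Rightarrow> 'v) \<Rightarrow> bool" where
  "lin_op F \<longleftrightarrow> (\<forall>v\<in>V. F v \<in> V) \<and> (\<forall>v\<in>V. \<forall>w\<in>V. F (v + w) = F v + F w) \<and>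
     (\<forall>c. \<forall>v\<in>V. F (sv c v) = sv c (F v))"

definition lie_module ::
    "(complex \<Rightarrow> 'g \<Rightarrow> 'g) \<Rightarrow> ('g \<Rightarrow> 'g \<Rightarrow> 'g::ab_group_add) \<Rightarrow> ('g \<Rightarrow> 'v \<Rightarrow> 'v) \<Rightarrow> bool" where
  "lie_module sc br D \<longleftrightarrow> (\<forall>x. lin_op (D x)) \<and>
     (\<forall>v\<in>V. (\<forall>x y. D (x + y) v = D x v + D y v) \<and> (\<forall>c x. D (sc c x) v = sv c (D x v)) \<and>
       (\<forall>x y. D (br x y) v = D x (D y v) - D y (D x v)))"

definition alg_module ::
    "(complex \<Rightarrow> 'u \<Rightarrow> 'u) \<Rightarrow> ('u::ring_1 \<Rightarrow> 'v \<Rightarrow> 'v) \<Rightarrow> bool" where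
  "alg_module su R \<longleftrightarrow> (\<forall>u. lin_op (R u)) \<and>
     (\<forall>v\<in>V. R 1 v = v \<and> (\<forall>u w. R (u + w) v = R u v + R w v) \<and> (\<forall>c u. R (su c u) v = sv c (R u v)) \<and>
       (\<forall>u w. R (u * w) v = R u (R w v)))"

lemma V_closed [simp]:
  "0 \<in> V" "v \<in> V \<Longrightarrow> w \<in> V \<Longrightarrow> v + w \<in> V" "v \<in> V \<Longrightarrow> w \<in> V \<Longrightarrow> v - w \<in> V" "v \<in> V \<Longrightarrow> sv c v \<in> V"
  using subspace_V by (simp_all add: subspace_0 subspace_add subspace_diff subspace_scale)

lemma lin_opD:
  assumes "lin_op F" "v \<in> V"
  shows "F v \<in> V" "w \<in> V \<Longrightarrow> F (v + w) = F v + F w" "F (sv c v) = sv c (F v)"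
    "F 0 = 0" "F (- v) = - F v" "w \<in> V \<Longrightarrow> F (v - w) = F v - F w"
proof -
  show 1: "F v \<in> V" "w \<in> V \<Longrightarrow> F (v + w) = F v + F w" "F (sv c v) = sv c (F v)" for w c
    using assms by (auto simp: lin_op_def)
  show "F 0 = 0" using 1(3)[of 0] by simp
  show 2: "F (- v) = - F v" using 1(3)[of "- 1"] by simp
  show "F (v - w) = F v - F w" if "w \<in> V"
  proof -
    have "v - w \<in> V" using that assms by simp
    then have "F ((v - w) + w) = F (v - w) + F w"
      using that assms(1) by (simp only: lin_op_def)
    then show ?thesis by simp
  qed
qed

lemma lin_op_lie_act: "(\<And>x. lin_op (\<gamma> x)) \<Longrightarrow> lin_op (lie_act sv \<gamma> t)"
proof (induction t)
  case (LBracket s t)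
  then have "lin_op (lie_act sv \<gamma> s)" "lin_op (lie_act sv \<gamma> t)" by auto
  then show ?case
    by (auto simp: lin_op_def scale_right_diff_distrib)
qed (auto simp: lin_op_def scale_right_distrib scale_left_commute)

lemma lin_op_alg_act: "(\<And>x. lin_op (\<gamma> x)) \<Longrightarrow> lin_op (alg_act sv \<gamma> t)"
  by (induction t) (auto simp: lin_op_def scale_right_distrib scale_left_commute)

text \<open>Commutators of linear operators satisfy the axioms of a Lie algebra, so each rule of the
  congruence preserves the action; linearity on \<open>V\<close> is what moves an operator past a
  sum, a difference or a scalar.\<close>

lemma lie_act_cong:
  assumes "\<And>x. lin_op (\<gamma> x)"
    and "\<And>s t v. R s t \<Longrightarrow> v \<in> V \<Longrightarrow> lie_act sv \<gamma> s v = lie_act sv \<gamma> t v"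
    and "lie_cong R s t"
  shows "\<forall>v\<in>V. lie_act sv \<gamma> s v = lie_act sv \<gamma> t v"
proof -
  note L = lin_opD[OF lin_op_lie_act[of \<gamma>, OF assms(1)]]
  show ?thesis
    using assms(3)
  proof induction
    case (7 s s' t t')
    then show ?case using L by simp
  next
    case (16 s t u)
    then show ?case using L by simp
  next
    case (17 s t u)
    then show ?case using L by simp
  next
    case (18 c s t)
    then show ?case using L by (simp add: scale_right_diff_distrib)
  next
    case (19 s c t)
    then show ?case using L by (simp add: scale_right_diff_distrib)
  next
    case (21 s t u)
    then show ?case using L by simp
  qed (auto simp: assms(2) scale_right_distrib scale_left_distrib algebra_simps)
qed

lemma alg_act_cong:
  assumes "lie_module sc br D" and "env_cong sc br s t"
  shows "\<forall>v\<in>V. alg_act sv D s v = alg_act sv D t v"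
proof -
  have lin: "lin_op (D x)" for x using assms(1) by (simp add: lie_module_def)
  note L = lin_opD[OF lin_op_alg_act[of D, OF lin]]
  show ?thesis
    using assms(2)
  proof induction
    case (9 s s' t t')
    then show ?case using L by simp
  qed (use assms(1) L in \<open>auto simp: lie_module_def scale_right_distrib scale_left_distrib algebra_simps\<close>)
qed

text \<open>Every element is the value of a term in the generators, and two such terms with the same
  value are congruent. The operator on \<open>V\<close> therefore does not depend on the term chosen
  by \<open>term_of\<close>.\<close>

lemma lie_module_of_presentation:
  assumes pres: "lie_presentation sc br X R \<gamma>"
    and lin: "\<And>x. lin_op (\<delta> x)"
    and rel: "\<And>s t v. R s t \<Longrightarrow> v \<in> V \<Longrightarrow> lie_act sv \<delta> s v = lie_act sv \<delta> t v"
  obtains D where "lie_module sc br D" and "\<And>x v. x \<in> X \<Longrightarrow> v \<in> V \<Longrightarrow> D (\<gamma> x) v = \<delta> x v"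
proof -
  define term_of where "term_of x = (SOME t. set_lie_term t \<subseteq> X \<and> lie_eval sc br \<gamma> t = x)" for x
  define D where "D x = lie_act sv \<delta> (term_of x)" for x
  have T: "set_lie_term (term_of x) \<subseteq> X" "lie_eval sc br \<gamma> (term_of x) = x" for x
    using someI_ex[of "\<lambda>t. set_lie_term t \<subseteq> X \<and> lie_eval sc br \<gamma> t = x"] pres
    unfolding term_of_def lie_presentation_def by auto
  have key: "D x v = lie_act sv \<delta> t v"
    if "set_lie_term t \<subseteq> X" "lie_eval sc br \<gamma> t = x" "v \<in> V" for t x v
  proof -
    have "lie_cong R (term_of x) t"
      using pres T that unfolding lie_presentation_def by metis
    then show ?thesis using lie_act_cong[of \<delta> R, OF lin rel] that unfolding D_def by blast
  qed
  have "lin_op (D x)" for x unfolding D_def by (rule lin_op_lie_act[OF lin])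
  moreover have "D (x + y) v = D x v + D y v" if "v \<in> V" for x y v
    using key[of "LAdd (term_of x) (term_of y)" "x + y" v] T that by (simp add: D_def)
  moreover have "D (sc c x) v = sv c (D x v)" if "v \<in> V" for c x v
    using key[of "LScale c (term_of x)" "sc c x" v] T that by (simp add: D_def)
  moreover have "D (br x y) v = D x (D y v) - D y (D x v)" if "v \<in> V" for x y v
    using key[of "LBracket (term_of x) (term_of y)" "br x y" v] T that by (simp add: D_def)
  ultimately have "lie_module sc br D" by (simp add: lie_module_def)
  moreover have "D (\<gamma> x) v = \<delta> x v" if "x \<in> X" "v \<in> V" for x v
    using key[of "LGen x" "\<gamma> x" v] that by simp
  ultimately show thesis by (rule that)
qed

text \<open>The universal property of the enveloping algebra, read for modules; again elements act
  through an arbitrary term representing them.\<close>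

lemma alg_module_of_lie_module:
  assumes env: "enveloping_algebra G U"
    and D: "lie_module (lscale G) (lbracket G) D"
  obtains R where "alg_module (ascale U) R" and "\<And>x v. v \<in> V \<Longrightarrow> R (incl U x) v = D x v"
proof -
  define term_of where "term_of u = (SOME t. alg_eval (ascale U) (incl U) t = u)" for u
  define R where "R u = alg_act sv D (term_of u)" for u
  have T: "alg_eval (ascale U) (incl U) (term_of u) = u" for u
    using someI_ex[of "\<lambda>t. alg_eval (ascale U) (incl U) t = u"] env
    unfolding term_of_def enveloping_algebra_def by auto
  have key: "R u v = alg_act sv D t v"
    if "alg_eval (ascale U) (incl U) t = u" "v \<in> V" for t u v
  proof -
    have "env_cong (lscale G) (lbracket G) (term_of u) t"
      using env T that unfolding enveloping_algebra_def by metis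
    then show ?thesis using alg_act_cong[OF D] that unfolding R_def by blast
  qed
  have "lin_op (R u)" for u unfolding R_def
    by (rule lin_op_alg_act) (use D in \<open>simp add: lie_module_def\<close>)
  moreover have "R 1 v = v" if "v \<in> V" for v
    using key[of AOne 1 v] that by simp
  moreover have "R (u + w) v = R u v + R w v" if "v \<in> V" for u w v
    using key[of "AAdd (term_of u) (term_of w)" "u + w" v] T that by (simp add: R_def)
  moreover have "R (ascale U c u) v = sv c (R u v)" if "v \<in> V" for c u v
    using key[of "AScale c (term_of u)" "ascale U c u" v] T that by (simp add: R_def)
  moreover have "R (u * w) v = R u (R w v)" if "v \<in> V" for u w v
    using key[of "AMult (term_of u) (term_of w)" "u * w" v] T that by (simp add: R_def)
  ultimately have "alg_module (ascale U) R" by (simp add: alg_module_def)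
  moreover have "R (incl U x) v = D x v" if "v \<in> V" for x v
    using key[of "AGen x" "incl U x" v] that by simp
  ultimately show thesis by (rule that)
qed

lemma alg_moduleD:
  assumes "alg_module su R" "v \<in> V"
  shows "R u v \<in> V" "w \<in> V \<Longrightarrow> R u (v + w) = R u v + R u w" "R u (sv c v) = sv c (R u v)"
    "R 1 v = v" "R (a + b) v = R a v + R b v" "R (su c a) v = sv c (R a v)"
    "R (a * b) v = R a (R b v)" "R (a - b) v = R a v - R b v"
proof -
  show "R u v \<in> V" "w \<in> V \<Longrightarrow> R u (v + w) = R u v + R u w" "R u (sv c v) = sv c (R u v)"
    "R 1 v = v" "R (su c a) v = sv c (R a v)" "R (a * b) v = R a (R b v)"
    using assms by (auto simp: alg_module_def lin_op_def)
  show *: "R (a + b) v = R a v + R b v" for a b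
    using assms by (auto simp: alg_module_def)
  show "R (a - b) v = R a v - R b v"
    using *[of "a - b" b] by (simp add: algebra_simps)
qed

end

section \<open>The enveloping algebra over the integers\<close>

definition fun_scale :: "complex \<Rightarrow> ('s \<Rightarrow> complex) \<Rightarrow> 's \<Rightarrow> complex" where
  "fun_scale c f = (\<lambda>s. c * f s)"

lemma vector_space_fun_scale: "vector_space fun_scale"
  by unfold_locales (auto simp: fun_scale_def fun_eq_iff algebra_simps)

text \<open>An additive function need not commute with complex scalars, but an integer can be moved
  from its argument to its value.\<close>

primrec integral_term :: "'x lie_term \<Rightarrow> bool" where
  "integral_term (LGen x) \<longleftrightarrow> True"
| "integral_term LZero \<longleftrightarrow> True"
| "integral_term (LAdd s t) \<longleftrightarrow> integral_term s \<and> integral_term t"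
| "integral_term (LScale c t) \<longleftrightarrow> c \<in> \<int> \<and> integral_term t"
| "integral_term (LBracket s t) \<longleftrightarrow> integral_term s \<and> integral_term t"

lemma integral_term_bracket_power: "integral_term s \<Longrightarrow> integral_term t \<Longrightarrow> integral_term ((LBracket s ^^ n) t)"
  by (induction n) auto

lemma set_lie_term_bracket_power:
  "set_lie_term ((LBracket s ^^ n) t) \<subseteq> set_lie_term s \<union> set_lie_term t"
  by (induction n) auto

lemma km_rel_integral: "km_rel S s t \<Longrightarrow> integral_term s \<and> integral_term t"
  by (induction rule: km_rel.induct) (auto intro!: integral_term_bracket_power)

text \<open>The presentation equates the values of congruent terms only if both are terms in these
  generators.\<close>

lemma km_rel_generators:
  "km_rel S s t \<Longrightarrow>
    set_lie_term s \<union> set_lie_term t \<subseteq> GenE ` index S \<union> GenF ` index S \<union> range GenH"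
proof (induction rule: km_rel.induct)
  case (7 i j)
  then show ?case
    using set_lie_term_bracket_power[of "nat (1 - cartan S i j)" "LGen (GenE i)" "LGen (GenE j)"] by auto
next
  case (8 i j)
  then show ?case
    using set_lie_term_bracket_power[of "nat (1 - cartan S i j)" "LGen (GenF i)" "LGen (GenF j)"] by auto
qed auto

lemma additive_of_int:
  fixes f :: "'u::ring_1 \<Rightarrow> complex"
  shows "additive f \<Longrightarrow> f (of_int k * u) = of_int k * f u"
proof (induction k rule: int_induct[where k = 0])
  case base
  then show ?case by (simp add: additive.zero)
next
  case (step1 i)
  then show ?case by (simp add: additive.add distrib_right)
next
  case (step2 i)
  then show ?case by (simp add: additive.diff left_diff_distrib)
qed

section \<open>Scalars and linear functionals on the enveloping algebra\<close>

locale km_env =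
  fixes S :: "('i, 'y::ab_group_add) root_data"
    and G :: "('i, 'y, 'g::ab_group_add) km_data"
    and U :: "('g, 'u::ring_1) env_data"
  assumes km: "kac_moody_algebra S G" and env: "enveloping_algebra G U"
begin

sublocale L: complex_lie_algebra "lscale G" "lbracket G"
  using km by (simp add: kac_moody_algebra_def lie_presentation_def)

sublocale A: complex_algebra "ascale U"
  using env by (simp add: enveloping_algebra_def)

abbreviation "UZ \<equiv> int_env S G U"
abbreviation "gZ \<equiv> int_lie S G U"

lemma eval_cong: "env_cong (lscale G) (lbracket G) s t \<Longrightarrow>
    alg_eval (ascale U) (incl U) s = alg_eval (ascale U) (incl U) t"
  using env by (simp add: enveloping_algebra_def)

lemma incl_add: "incl U (x + y) = incl U x + incl U y"
  using eval_cong[OF env_cong.intros(1)[of _ _ x y]] by simp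

lemma incl_scale: "incl U (lscale G c x) = ascale U c (incl U x)"
  using eval_cong[OF env_cong.intros(2)[of _ _ c x]] by simp

lemma incl_bracket: "incl U (lbracket G x y) = incl U x * incl U y - incl U y * incl U x"
  using eval_cong[OF env_cong.intros(3)[of _ _ x y]] by simp

lemma incl_additive: "additive (incl U)"
  by unfold_locales (rule incl_add)

lemmas incl_zero = additive.zero[OF incl_additive]
lemmas incl_diff = additive.diff[OF incl_additive]

lemma ascale_of_int: "ascale U (of_int k) u = of_int k * u"
proof (induction k rule: int_induct[where k = 0])
  case (step1 i)
  then show ?case by (simp add: A.scale_left_distrib distrib_right)
next
  case (step2 i)
  then show ?case by (simp add: A.scale_left_diff_distrib left_diff_distrib)
qed simp

lemma ascale_of_nat: "ascale U (of_nat k) u = of_nat k * u"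
  using ascale_of_int[of "int k" u] by simp

lemma zmul_env: "zmul k u = ascale U (of_int k) u"
proof (induction k rule: int_induct[where k = 0])
  case (step1 i)
  then show ?case by (simp add: A.scale_left_distrib zmul_succ)
next
  case (step2 i)
  then show ?case using zmul_succ[of "i - 1" u]
    by (simp add: A.scale_left_diff_distrib eq_diff_eq)
qed simp

lemma zmul_lie: "zmul k x = lscale G (of_int k) x"
proof (induction k rule: int_induct[where k = 0])
  case (step1 i)
  then show ?case by (simp add: L.scale_left_distrib zmul_succ)
next
  case (step2 i)
  then show ?case using zmul_succ[of "i - 1" x]
    by (simp add: L.scale_left_diff_distrib eq_diff_eq)
qed simp

lemma incl_zmul: "incl U (zmul k x) = zmul k (incl U x)"
  by (simp add: zmul_lie zmul_env incl_scale)

text \<open>An additive function commutes with integers, and the denominator can be cancelled among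
  its complex values.\<close>

lemma additive_ascale_of_rat:
  fixes f :: "'u \<Rightarrow> complex"
  assumes "additive f"
  shows "f (ascale U (of_rat q) u) = of_rat q * f u"
proof -
  obtain a b where ab: "quotient_of q = (a, b)" by force
  then have b: "b > 0" and q: "q = of_int a / of_int b"
    by (simp_all add: quotient_of_denom_pos quotient_of_div)
  have *: "of_int b * of_rat q = (of_int a :: complex)"
    using b by (simp add: q of_rat_divide)
  have "of_int b * f (ascale U (of_rat q) u) = f (ascale U (of_int b * of_rat q) u)"
    using additive_of_int[OF assms, of b "ascale U (of_rat q) u"]
    by (simp only: ascale_of_int[symmetric] A.scale_scale)
  also have "\<dots> = of_int b * (of_rat q * f u)"
    using additive_of_int[OF assms, of a u] by (simp add: * ascale_of_int mult.assoc[symmetric])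
  finally show ?thesis using b by simp
qed

lemma additive_ascale_inverse_fact:
  fixes f :: "'u \<Rightarrow> complex"
  assumes "additive f"
  shows "f (ascale U (1 / fact n) u) = (1 / fact n) * f u"
proof -
  have "(1 / fact n :: complex) = of_rat (1 / of_nat (fact n))"
    by (metis of_nat_fact of_rat_1 of_rat_divide of_rat_of_nat_eq)
  then show ?thesis using additive_ascale_of_rat[OF assms] by metis
qed

definition functional :: "('u \<Rightarrow> complex) \<Rightarrow> bool" where
  "functional f \<longleftrightarrow> (\<forall>u w. f (u + w) = f u + f w) \<and> (\<forall>c u. f (ascale U c u) = c * f u)"

lemma functional_additive: "functional f \<Longrightarrow> additive f"
  by (simp add: functional_def additive_def)

lemma functional_scale: "functional f \<Longrightarrow> f (ascale U c u) = c * f u"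
  by (simp add: functional_def)

lemma functional_zmul: "functional f \<Longrightarrow> f (zmul k u) = of_int k * f u"
  by (simp add: functional_def zmul_env)

text \<open>The relations of the Kac--Moody algebra are integral, so \<open>\<gg>\<close> acts on the additive functions
  \<open>\<U> \<rightarrow> \<complex>\<close>, the generators by right multiplication on the argument and the complex scalars by
  multiplication of the values. This expresses that \<open>\<U> \<otimes> \<complex>\<close> embeds into the enveloping algebra.\<close>

theorem linearization:
  fixes f :: "'u \<Rightarrow> complex"
  assumes f: "additive f"
  obtains F where "functional F" "\<And>u. u \<in> UZ \<Longrightarrow> F u = f u"
proof -
  define V where "V = {f :: 'u \<Rightarrow> complex. additive f}"
  interpret V: operator_space fun_scale V
  proof -
    interpret vector_space fun_scale by (rule vector_space_fun_scale)
    show "operator_space fun_scale V"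
      by unfold_locales
        (auto simp: V_def subspace_def fun_scale_def additive_def algebra_simps)
  qed
  have V_iff: "f \<in> V \<longleftrightarrow> additive f" for f by (simp add: V_def)
  define \<gamma> :: "('i, 'y) km_gen \<Rightarrow> 'g" where "\<gamma> = case_km_gen (gen_e G) (gen_f G) (gen_h G)"
  define X :: "('i, 'y) km_gen set" where "X = GenE ` index S \<union> GenF ` index S \<union> range GenH"
  define \<delta> where "\<delta> x f = (\<lambda>a. f (a * incl U (\<gamma> x)))" for x and f :: "'u \<Rightarrow> complex"
  have pres: "lie_presentation (lscale G) (lbracket G) X (km_rel S) \<gamma>"
    using km by (simp add: kac_moody_algebra_def X_def \<gamma>_def)
  have add: "additive (\<lambda>a. f (a * u))" if "additive f" for f :: "'u \<Rightarrow> complex" and u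
    using that by (simp add: additive_def distrib_right)
  have lin: "V.lin_op (\<delta> x)" for x
    by (auto simp: V.lin_op_def \<delta>_def V_iff fun_scale_def fun_eq_iff add)
  have act: "lie_act fun_scale \<delta> t f = (\<lambda>a. f (a * incl U (lie_eval (lscale G) (lbracket G) \<gamma> t)))"
    if "integral_term t" "additive f" for t f
    using that
  proof (induction t arbitrary: f)
    case (LGen x)
    then show ?case by (simp add: \<delta>_def)
  next
    case LZero
    then show ?case by (simp add: incl_zero additive.zero fun_eq_iff)
  next
    case (LAdd s t)
    then show ?case by (simp add: fun_eq_iff incl_add distrib_left additive.add)
  next
    case (LScale c t)
    then obtain k where "c = of_int k" by (auto elim: Ints_cases)
    then show ?case using LScale additive_of_int[of f k]
      by (simp add: fun_eq_iff fun_scale_def incl_scale A.scale_mult_right ascale_of_int[symmetric])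
  next
    case (LBracket s t)
    then have "lie_act fun_scale \<delta> (LBracket s t) f =
        (\<lambda>a. f (a * incl U (lie_eval (lscale G) (lbracket G) \<gamma> s) * incl U (lie_eval (lscale G) (lbracket G) \<gamma> t)))
        - (\<lambda>a. f (a * incl U (lie_eval (lscale G) (lbracket G) \<gamma> t) * incl U (lie_eval (lscale G) (lbracket G) \<gamma> s)))"
      by (simp add: add)
    then show ?case using LBracket.prems
      by (simp add: fun_eq_iff incl_bracket right_diff_distrib additive.diff mult.assoc)
  qed
  have rel: "lie_act fun_scale \<delta> s f = lie_act fun_scale \<delta> t f" if "km_rel S s t" "f \<in> V" for s t f
  proof -
    have "lie_eval (lscale G) (lbracket G) \<gamma> s = lie_eval (lscale G) (lbracket G) \<gamma> t"
      using pres km_rel_generators[OF that(1)] lie_cong.intros(1)[of "km_rel S", OF that(1)]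
      unfolding lie_presentation_def X_def by simp
    then show ?thesis
      using that km_rel_integral[OF that(1)] by (simp add: act V_def)
  qed
  obtain D where D: "V.lie_module (lscale G) (lbracket G) D"
    and D_gen: "\<And>x v. x \<in> X \<Longrightarrow> v \<in> V \<Longrightarrow> D (\<gamma> x) v = \<delta> x v"
    using V.lie_module_of_presentation[OF pres lin rel] by blast
  obtain R where R: "V.alg_module (ascale U) R" and R_incl: "\<And>x v. v \<in> V \<Longrightarrow> R (incl U x) v = D x v"
    using V.alg_module_of_lie_module[OF env D] by blast
  note R = V.alg_moduleD[OF R]
  \<comment> \<open>\<open>K\<close> consists of the elements that act on all additive functions by
    right multiplication of the argument. It contains the generators and admits division by
    factorials, hence contains \<open>UZ\<close>.\<close>
  define K where "K = {u. \<forall>f\<in>V. R u f = (\<lambda>a. f (a * u))}"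
  have K_gen: "incl U (\<gamma> x) \<in> K" if "x \<in> X" for x
    using that by (simp add: K_def R_incl D_gen \<delta>_def)
  have K_one: "1 \<in> K" by (simp add: K_def R)
  have K_diff: "u - w \<in> K" if "u \<in> K" "w \<in> K" for u w
    using that by (auto simp: K_def R fun_eq_iff V_def right_diff_distrib additive.diff)
  have K_mult: "u * w \<in> K" if "u \<in> K" "w \<in> K" for u w
  proof -
    have "(\<lambda>a. f (a * w)) \<in> V" if "f \<in> V" for f using that add by (simp add: V_def)
    then show ?thesis using that by (simp add: K_def R mult.assoc)
  qed
  have K_scale: "ascale U (1 / fact n) u \<in> K" if "u \<in> K" for u n
    using that additive_ascale_inverse_fact
    by (auto simp: K_def R fun_eq_iff fun_scale_def A.scale_mult_right V_def)
  have K_zero: "0 \<in> K" using K_diff[OF K_one K_one] by simp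
  have K_of_nat: "of_nat n \<in> K" for n
  proof (induction n)
    case (Suc n)
    have "of_nat (Suc n) = (of_nat n :: 'u) - (0 - 1)" by simp
    then show ?case using Suc K_diff K_zero K_one by metis
  qed (simp add: K_zero)
  have K_power: "u ^ n \<in> K" if "u \<in> K" for u n
    by (induction n) (auto simp: K_one K_mult that)
  have K_prod: "prod_list us \<in> K" if "set us \<subseteq> K" for us
    using that by (induction us) (auto simp: K_one K_mult)
  have K_UZ: "u \<in> K" if "u \<in> UZ" for u
    using that
  proof induction
    case (1 i n)
    have "incl U (gen_e G i) \<in> K" using K_gen[of "GenE i"] 1 by (simp add: \<gamma>_def X_def)
    then show ?case unfolding divpow_def by (intro K_scale K_power)
  next
    case (2 i n)
    have "incl U (gen_f G i) \<in> K" using K_gen[of "GenF i"] 2 by (simp add: \<gamma>_def X_def)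
    then show ?case unfolding divpow_def by (intro K_scale K_power)
  next
    case (3 y n)
    have "incl U (gen_h G y) \<in> K" using K_gen[of "GenH y"] by (simp add: \<gamma>_def X_def)
    then show ?case unfolding env_binomial_def by (intro K_scale K_prod) (auto intro: K_diff K_of_nat)
  qed (auto intro: K_one K_diff K_mult)
  have fV: "f \<in> V" using f by (simp add: V_def)
  show thesis
  proof
    \<comment> \<open>Evaluation at \<open>1\<close> makes the action complex linear in
      \<open>u\<close>; on \<open>K\<close> it returns \<open>f (1 * u)\<close>.\<close>
    show "functional (\<lambda>u. R u f 1)" by (simp add: functional_def R fV fun_scale_def)
    show "R u f 1 = f u" if "u \<in> UZ" for u using K_UZ[OF that] fV by (simp add: K_def)
  qed
qed

text \<open>Let the Lie algebra act by zero on the complex numbers; \<open>\<epsilon> u\<close> is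
  the scalar by which \<open>u\<close> then acts.\<close>

lemma ex_augmentation:
  "\<exists>\<epsilon>. functional \<epsilon> \<and> \<epsilon> 1 = 1 \<and> (\<forall>u w. \<epsilon> (u * w) = \<epsilon> u * \<epsilon> w) \<and> (\<forall>x. \<epsilon> (incl U x) = 0)"
proof -
  interpret vector_space "(*) :: complex \<Rightarrow> complex \<Rightarrow> complex"
    by unfold_locales (auto simp: algebra_simps)
  interpret V: operator_space "(*) :: complex \<Rightarrow> complex \<Rightarrow> complex" UNIV
    by unfold_locales simp
  have "V.lie_module (lscale G) (lbracket G) (\<lambda>x v. 0)"
    by (simp add: V.lie_module_def V.lin_op_def)
  then obtain R where R: "V.alg_module (ascale U) R" "\<And>x v. R (incl U x) v = 0"
    using V.alg_module_of_lie_module[OF env] by (metis UNIV_I)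
  note M = V.alg_moduleD[OF R(1) UNIV_I]
  have *: "R u c = c * R u 1" for u c using M(3)[of u c 1] by simp
  show ?thesis
  proof (intro exI conjI allI)
    show "functional (\<lambda>u. R u 1)" by (simp add: functional_def M)
    show "R (u * w) 1 = R u 1 * R w 1" for u w using M(7)[of u w 1] *[of u "R w 1"] by simp
  qed (simp_all add: R M)
qed

definition augmentation :: "'u \<Rightarrow> complex" where
  "augmentation = (SOME \<epsilon>. functional \<epsilon> \<and> \<epsilon> 1 = 1 \<and> (\<forall>u w. \<epsilon> (u * w) = \<epsilon> u * \<epsilon> w) \<and> (\<forall>x. \<epsilon> (incl U x) = 0))"

lemma functional_augmentation: "functional augmentation"
  and augmentation_one: "augmentation 1 = 1"
  and augmentation_mult: "augmentation (u * w) = augmentation u * augmentation w"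
  and augmentation_incl: "augmentation (incl U x) = 0"
  using someI_ex[OF ex_augmentation] unfolding augmentation_def by blast+

lemma augmentation_divpow: "augmentation (divpow U (incl U x) n) \<in> \<int>"
  by (cases n) (simp_all add: divpow_def augmentation_mult augmentation_one augmentation_incl
    functional_scale[OF functional_augmentation])

lemma augmentation_UZ: "u \<in> UZ \<Longrightarrow> augmentation u \<in> \<int>"
proof (induction rule: int_env.induct)
  case (3 y n)
  show ?case
  proof (cases n)
    case 0
    then show ?thesis by (simp add: env_binomial_def augmentation_one)
  next
    case (Suc m)
    \<comment> \<open>The first factor of the binomial is the Lie element itself, which the
      augmentation kills.\<close>
    have "[0..<n] = 0 # [1..<n]" using Suc upt_conv_Cons[of 0 n] by simp
    then show ?thesis
      by (simp add: env_binomial_def augmentation_mult augmentation_incl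
          functional_scale[OF functional_augmentation])
  qed
next
  case (5 u v)
  then show ?case by (simp add: additive.diff[OF functional_additive[OF functional_augmentation]])
qed (auto simp: augmentation_mult augmentation_one augmentation_divpow)

end

section \<open>Convolution of linear functionals\<close>

text \<open>The two lists of a pair are complementary sublists. Such pairs index the terms in the
  coproduct of a product of primitive elements.\<close>

primrec splits :: "'a list \<Rightarrow> ('a list \<times> 'a list) list" where
  "splits [] = [([], [])]"
| "splits (x # xs) = map (\<lambda>(p, q). (x # p, q)) (splits xs) @ map (\<lambda>(p, q). (p, x # q)) (splits xs)"

lemma set_splits: "(p, q) \<in> set (splits xs) \<Longrightarrow>
    length p + length q = length xs \<and> set p \<subseteq> set xs \<and> set q \<subseteq> set xs"
  by (induction xs arbitrary: p q) fastforce+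

text \<open>A one-element left part amounts to a position of \<open>xs\<close>. The positions
  carrying \<open>b\<close> all leave the same multiset on the right, so they contribute
  equally.\<close>

lemma splits_singleton:
  fixes g :: "'a multiset \<Rightarrow> 'b::comm_semiring_1"
  shows "(\<Sum>(p, q)\<leftarrow>splits xs. if length p = 1 then of_bool (p = [b]) * g (mset q) else 0) =
    of_nat (count (mset xs) b) * g (mset xs - {#b#})"
proof (induction xs arbitrary: g)
  case (Cons x xs)
  have 0: "(\<Sum>(p, q)\<leftarrow>splits ys. if p = [] then z * g (mset q) else 0) = z * g (mset ys)" for ys z
  proof (induction ys arbitrary: g)
    case (Cons a ys)
    then show ?case using Cons.IH[of "\<lambda>M. g (add_mset a M)"]
      by (simp add: o_def case_prod_unfold cong: if_cong)
  qed simp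
  have 1: "(\<Sum>(p, q)\<leftarrow>splits xs. if length p = 1 then of_bool (p = [b]) * g (add_mset x (mset q)) else 0) =
      of_nat (count (mset xs) b) * g (add_mset x (mset xs - {#b#}))"
    using Cons.IH[of "\<lambda>M. g (add_mset x M)"] by simp
  have 2: "(\<lambda>(p, q). if length p = 1 then of_bool (p = [b]) * g (mset q) else 0) \<circ> (\<lambda>(p, q). (x # p, q)) =
      (\<lambda>(p, q). if p = [] then of_bool (x = b) * g (mset q) else 0)"
    by (auto simp: fun_eq_iff)
  have 3: "(\<lambda>(p, q). if length p = 1 then of_bool (p = [b]) * g (mset q) else 0) \<circ> (\<lambda>(p, q). (p, x # q)) =
      (\<lambda>(p, q). if length p = 1 then of_bool (p = [b]) * g (add_mset x (mset q)) else 0)"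
    by (auto simp: fun_eq_iff)
  have "(\<Sum>(p, q)\<leftarrow>splits (x # xs). if length p = 1 then of_bool (p = [b]) * g (mset q) else 0) =
      of_bool (x = b) * g (mset xs) + of_nat (count (mset xs) b) * g (add_mset x (mset xs - {#b#}))"
    by (simp only: splits.simps map_append sum_list_append map_map 0 1 2 3)
  moreover have count: "b \<notin> set xs \<Longrightarrow> count (mset xs) b = 0"
    by (simp add: count_eq_zero_iff)
  ultimately show ?case
    by (cases "b \<in> set xs") (auto simp: distrib_right count)
qed simp

lemma commutes_prod_list_shifts:
  fixes u :: "'a::ring_1"
  shows "u * prod_list (map (\<lambda>k. u - of_nat k) ks) = prod_list (map (\<lambda>k. u - of_nat k) ks) * u"
proof (induction ks)
  case (Cons k ks)
  have "u * (u - of_nat k) = (u - of_nat k) * u"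
    by (simp add: algebra_simps mult_of_nat_commute)
  then show ?case using Cons by simp (metis mult.assoc)
qed simp

section \<open>The coproduct, through its action on bilinear forms\<close>

context km_env
begin

definition bilinear :: "('u \<times> 'u \<Rightarrow> complex) \<Rightarrow> bool" where
  "bilinear \<beta> \<longleftrightarrow> (\<forall>b. functional (\<lambda>a. \<beta> (a, b))) \<and> (\<forall>a. functional (\<lambda>b. \<beta> (a, b)))"

sublocale B: operator_space fun_scale "Collect bilinear"
proof -
  interpret vector_space fun_scale by (rule vector_space_fun_scale)
  show "operator_space fun_scale (Collect bilinear)"
    by unfold_locales
      (auto simp: subspace_def bilinear_def functional_def fun_scale_def algebra_simps)
qed

lemma bilinear_simps:
  assumes "bilinear \<beta>"
  shows "\<beta> (a + a', b) = \<beta> (a, b) + \<beta> (a', b)" "\<beta> (a, b + b') = \<beta> (a, b) + \<beta> (a, b')"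
    "\<beta> (a - a', b) = \<beta> (a, b) - \<beta> (a', b)" "\<beta> (a, b - b') = \<beta> (a, b) - \<beta> (a, b')"
    "\<beta> (- a, b) = - \<beta> (a, b)"
    "\<beta> (ascale U c a, b) = c * \<beta> (a, b)" "\<beta> (a, ascale U c b) = c * \<beta> (a, b)"
proof -
  have 1: "functional (\<lambda>a. \<beta> (a, b))" "functional (\<lambda>b. \<beta> (a, b))" for a b
    using assms by (auto simp: bilinear_def)
  show "\<beta> (a + a', b) = \<beta> (a, b) + \<beta> (a', b)" "\<beta> (a, b + b') = \<beta> (a, b) + \<beta> (a, b')"
    "\<beta> (ascale U c a, b) = c * \<beta> (a, b)" "\<beta> (a, ascale U c b) = c * \<beta> (a, b)"
    using 1 by (auto simp: functional_def)
  show "\<beta> (a - a', b) = \<beta> (a, b) - \<beta> (a', b)" "\<beta> (a, b - b') = \<beta> (a, b) - \<beta> (a, b')"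
    "\<beta> (- a, b) = - \<beta> (a, b)"
    using additive.diff[OF functional_additive[OF 1(1)]] additive.diff[OF functional_additive[OF 1(2)]]
      additive.minus[OF functional_additive[OF 1(1)]] by auto
qed

text \<open>Precomposition with right multiplication by u \<otimes> 1 + 1 \<otimes> u, which is the
  coproduct of \<open>u\<close> when \<open>u\<close> is a Lie element.\<close>

definition shift :: "'u \<Rightarrow> ('u \<times> 'u \<Rightarrow> complex) \<Rightarrow> 'u \<times> 'u \<Rightarrow> complex" where
  "shift u \<beta> = (\<lambda>(a, b). \<beta> (a * u, b) + \<beta> (a, b * u))"

text \<open>The action on bilinear forms \<open>\<beta>\<close> encodes the coproduct: it is \<open>\<beta>\<close> precomposed with right
  multiplication by \<open>\<nabla> u\<close>, without mention of tensor products.\<close>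

lemma ex_comult:
  "\<exists>\<Delta>. B.alg_module (ascale U) \<Delta> \<and> (\<forall>x. \<forall>\<beta>\<in>Collect bilinear. \<Delta> (incl U x) \<beta> = shift (incl U x) \<beta>)"
proof -
  have "B.lie_module (lscale G) (lbracket G) (\<lambda>x. shift (incl U x))"
    unfolding B.lie_module_def B.lin_op_def
  proof (intro conjI allI ballI)
    fix x and \<beta> assume "\<beta> \<in> Collect bilinear"
    then have "functional (\<lambda>a. shift (incl U x) \<beta> (a, b))" "functional (\<lambda>b. shift (incl U x) \<beta> (a, b))" for a b
      by (auto simp: functional_def shift_def bilinear_simps A.scale_mult_left algebra_simps)
    then show "shift (incl U x) \<beta> \<in> Collect bilinear" by (simp add: bilinear_def)
  qed (auto simp: shift_def fun_eq_iff fun_scale_def bilinear_simps incl_add incl_scale incl_bracket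
      algebra_simps A.scale_mult_right)
  then show ?thesis using B.alg_module_of_lie_module[OF env] by metis
qed

definition comult :: "'u \<Rightarrow> ('u \<times> 'u \<Rightarrow> complex) \<Rightarrow> 'u \<times> 'u \<Rightarrow> complex" where
  "comult = (SOME \<Delta>. B.alg_module (ascale U) \<Delta> \<and>
     (\<forall>x. \<forall>\<beta>\<in>Collect bilinear. \<Delta> (incl U x) \<beta> = shift (incl U x) \<beta>))"

lemma comult_module: "B.alg_module (ascale U) comult"
  and comult_incl: "bilinear \<beta> \<Longrightarrow> comult (incl U x) \<beta> = shift (incl U x) \<beta>"
  using someI_ex[OF ex_comult] unfolding comult_def by blast+

lemmas comult_simps = B.alg_moduleD[OF comult_module, unfolded mem_Collect_eq]

text \<open>Lie elements are primitive, so each factor goes to exactly one of the two sides, in the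
  original order.\<close>

lemma comult_prod_list:
  "bilinear \<beta> \<Longrightarrow> comult (prod_list (map (incl U) xs)) \<beta> (a, b) =
    (\<Sum>(p, q)\<leftarrow>splits xs. \<beta> (a * prod_list (map (incl U) p), b * prod_list (map (incl U) q)))"
proof (induction xs arbitrary: a b)
  case (Cons x xs)
  then show ?case
    by (simp add: comult_simps comult_incl shift_def o_def case_prod_unfold mult.assoc)
qed (simp add: comult_simps)

text \<open>With \<open>m = 0\<close> the recursion is that of divided powers, with
  \<open>m = 1\<close> that of binomial coefficients; the formula is then the binomial theorem or
  Vandermonde's identity for x \<otimes> 1 + 1 \<otimes> x. The induction proves it multiplied by
  \<open>Suc n\<close>.\<close>

lemma comult_divided_sequence:
  assumes "bilinear \<beta>" and X0: "X 0 = 1"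
    and X: "\<And>n. of_nat (Suc n) * X (Suc n) = (incl U x - of_nat (m * n)) * X n"
  shows "comult (X n) \<beta> (a, b) = (\<Sum>k\<le>n. \<beta> (a * X k, b * X (n - k)))"
proof (induction n arbitrary: a b)
  case 0
  then show ?case by (simp add: X0 comult_simps assms)
next
  case (Suc n)
  have xX: "incl U x * X k = ascale U (of_nat (Suc k)) (X (Suc k)) + ascale U (of_nat (m * k)) (X k)" for k
    using X[of k] by (simp only: ascale_of_nat) (simp add: algebra_simps)
  define g where "g k = \<beta> (a * X k, b * X (Suc n - k))" for k
  define h where "h k = \<beta> (a * X k, b * X (n - k))" for k
  have bil: "bilinear (comult (X n) \<beta>)" by (rule comult_simps(1)[OF assms(1)])
  have "of_nat (Suc n) * comult (X (Suc n)) \<beta> (a, b) =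
      comult (ascale U (of_nat (Suc n)) (X (Suc n))) \<beta> (a, b)"
    by (simp only: comult_simps(6)[OF assms(1)] fun_scale_def)
  also have "\<dots> = comult (incl U x * X n - ascale U (of_nat (m * n)) (X n)) \<beta> (a, b)"
    by (simp add: xX)
  also have "\<dots> = comult (X n) \<beta> (a * incl U x, b) + comult (X n) \<beta> (a, b * incl U x)
      - of_nat (m * n) * comult (X n) \<beta> (a, b)"
    using assms(1) bil by (simp add: comult_simps comult_incl shift_def fun_scale_def)
  also have "\<dots> = (\<Sum>k\<le>n. \<beta> (a * (incl U x * X k), b * X (n - k)) + \<beta> (a * X k, b * (incl U x * X (n - k)))
      - of_nat (m * n) * h k)"
    by (simp add: Suc.IH h_def sum.distrib sum_subtractf sum_distrib_left mult.assoc)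
  also have "\<dots> = (\<Sum>k\<le>n. of_nat (Suc k) * g (Suc k) + of_nat (Suc n - k) * g k)"
  proof (rule sum.cong)
    fix k assume "k \<in> {..n}"
    then have k: "k \<le> n" "Suc (n - k) = Suc n - k" by auto
    have "\<beta> (a * (incl U x * X k), b * X (n - k)) = of_nat (Suc k) * g (Suc k) + of_nat (m * k) * h k"
      using assms(1) by (simp only: xX distrib_left A.scale_mult_right bilinear_simps) (simp add: g_def h_def)
    moreover have "\<beta> (a * X k, b * (incl U x * X (n - k))) = of_nat (Suc n - k) * g k + of_nat (m * (n - k)) * h k"
      using assms(1) by (simp only: xX distrib_left A.scale_mult_right bilinear_simps k) (simp add: g_def h_def)
    \<comment> \<open>The corrections that the recursion produces on the two sides add up to the
      subtracted term \<open>of_nat (m * n) * h k\<close>.\<close>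
    moreover have "of_nat (m * k) * h k + of_nat (m * (n - k)) * h k = of_nat (m * n) * h k"
      using k by (simp only: distrib_right[symmetric] of_nat_add[symmetric]) (simp flip: distrib_left)
    ultimately show "\<beta> (a * (incl U x * X k), b * X (n - k)) + \<beta> (a * X k, b * (incl U x * X (n - k)))
      - of_nat (m * n) * h k = of_nat (Suc k) * g (Suc k) + of_nat (Suc n - k) * g k"
      by (simp add: algebra_simps)
  qed simp
  \<comment> \<open>After reindexing, both sums extend to \<open>0..Suc n\<close>, as the added
    terms have coefficient zero.\<close>
  also have "\<dots> = (\<Sum>k\<le>Suc n. of_nat k * g k) + (\<Sum>k\<le>Suc n. of_nat (Suc n - k) * g k)"
    by (simp only: sum.distrib sum.atMost_Suc_shift[of "\<lambda>k. of_nat k * g k"]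
        sum.atMost_Suc[of "\<lambda>k. of_nat (Suc n - k) * g k"]) simp
  also have "\<dots> = (\<Sum>k\<le>Suc n. of_nat (k + (Suc n - k)) * g k)"
    by (simp only: sum.distrib[symmetric] distrib_right of_nat_add)
  also have "\<dots> = of_nat (Suc n) * (\<Sum>k\<le>Suc n. g k)"
    unfolding sum_distrib_left by (rule sum.cong) auto
  finally show ?case
    by (simp only: g_def mult_cancel_left of_nat_eq_0_iff) simp
qed

section \<open>Closure of the integral form under the coproduct\<close>

lemma divpow_recursion:
  "of_nat (Suc n) * divpow U u (Suc n) = (u - of_nat (0 * n)) * divpow U u n"
proof -
  have "of_nat (Suc n) * divpow U u (Suc n) = ascale U (of_nat (Suc n) * (1 / fact (Suc n))) (u ^ Suc n)"
    by (simp only: divpow_def ascale_of_nat[symmetric] A.scale_scale)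
  also have "of_nat (Suc n) * (1 / fact (Suc n)) = (1 / fact n :: complex)"
    by (simp add: fact_Suc del: of_nat_Suc)
  finally show ?thesis by (simp add: divpow_def A.scale_mult_right)
qed

lemma env_binomial_recursion:
  "of_nat (Suc n) * env_binomial U u (Suc n) = (u - of_nat (1 * n)) * env_binomial U u n"
proof -
  let ?p = "prod_list (map (\<lambda>k. u - of_nat k) [0..<n])"
  have "of_nat (Suc n) * env_binomial U u (Suc n) =
      ascale U (of_nat (Suc n) * (1 / fact (Suc n))) (?p * (u - of_nat n))"
    by (simp only: env_binomial_def ascale_of_nat[symmetric] A.scale_scale upt_Suc_append map_append) simp
  also have "of_nat (Suc n) * (1 / fact (Suc n)) = (1 / fact n :: complex)"
    by (simp add: fact_Suc del: of_nat_Suc)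
  also have "?p * (u - of_nat n) = (u - of_nat n) * ?p"
    by (simp add: algebra_simps commutes_prod_list_shifts mult_of_nat_commute)
  finally show ?thesis by (simp add: env_binomial_def A.scale_mult_right)
qed

lemma UZ_zero: "0 \<in> UZ"
  using int_env.intros(5)[OF int_env.intros(4) int_env.intros(4)] by simp

lemma UZ_minus: "u \<in> UZ \<Longrightarrow> - u \<in> UZ"
  using int_env.intros(5)[OF UZ_zero] by fastforce

lemma UZ_add: "u \<in> UZ \<Longrightarrow> w \<in> UZ \<Longrightarrow> u + w \<in> UZ"
  using int_env.intros(5)[of u S G U "- w"] UZ_minus by simp

lemma comult_UZ_divided_sequence:
  assumes "\<And>n. X n \<in> UZ" "X 0 = 1"
    and "\<And>n. of_nat (Suc n) * X (Suc n) = (incl U x - of_nat (m * n)) * X n"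
  shows "\<exists>ps. set ps \<subseteq> UZ \<times> UZ \<and>
    (\<forall>\<beta> a b. bilinear \<beta> \<longrightarrow> comult (X n) \<beta> (a, b) = (\<Sum>(p, q)\<leftarrow>ps. \<beta> (a * p, b * q)))"
  using assms
  by (intro exI[of _ "map (\<lambda>k. (X k, X (n - k))) [0..<Suc n]"])
    (auto simp: comult_divided_sequence[OF _ assms(2,3)] o_def interv_sum_list_conv_sum_set_nat
      atLeast0LessThan lessThan_Suc_atMost simp del: upt_Suc)

text \<open>The coproduct is multiplicative, so it suffices to treat the generators, which are
  divided sequences. The list \<open>ps\<close> spells out the coproduct of \<open>u\<close> as a
  sum of tensors p \<otimes> q, the same for all forms and base points.\<close>

lemma comult_UZ:
  "u \<in> UZ \<Longrightarrow> \<exists>ps. set ps \<subseteq> UZ \<times> UZ \<and>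
    (\<forall>\<beta> a b. bilinear \<beta> \<longrightarrow> comult u \<beta> (a, b) = (\<Sum>(p, q)\<leftarrow>ps. \<beta> (a * p, b * q)))"
proof (induction rule: int_env.induct)
  case (1 i n)
  show ?case
    by (rule comult_UZ_divided_sequence[OF _ _ divpow_recursion])
      (use 1 in \<open>auto intro: int_env.intros simp: divpow_def[of _ _ 0]\<close>)
next
  case (2 i n)
  show ?case
    by (rule comult_UZ_divided_sequence[OF _ _ divpow_recursion])
      (use 2 in \<open>auto intro: int_env.intros simp: divpow_def[of _ _ 0]\<close>)
next
  case (3 y n)
  show ?case
    by (rule comult_UZ_divided_sequence[OF _ _ env_binomial_recursion])
      (auto intro: int_env.intros simp: env_binomial_def[of _ _ 0])
next
  case 4
  show ?case
    by (rule exI[of _ "[(1, 1)]"]) (auto intro: int_env.intros simp: comult_simps)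
next
  case (5 u v)
  then obtain ps qs where ps: "set ps \<subseteq> UZ \<times> UZ"
      "\<And>\<beta> a b. bilinear \<beta> \<Longrightarrow> comult u \<beta> (a, b) = (\<Sum>(p, q)\<leftarrow>ps. \<beta> (a * p, b * q))"
    and qs: "set qs \<subseteq> UZ \<times> UZ"
      "\<And>\<beta> a b. bilinear \<beta> \<Longrightarrow> comult v \<beta> (a, b) = (\<Sum>(p, q)\<leftarrow>qs. \<beta> (a * p, b * q))"
    by metis
  \<comment> \<open>The sign of a subtracted term is absorbed into its left tensor factor, which
    stays in \<open>UZ\<close>.\<close>
  have "(\<Sum>(p, q)\<leftarrow>qs. \<beta> (a * - p, b * q)) = - (\<Sum>(p, q)\<leftarrow>qs. \<beta> (a * p, b * q))"
    if "bilinear \<beta>" for \<beta> a b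
    using that by (induction qs) (auto simp: bilinear_simps)
  then show ?case
    using ps qs UZ_minus
    by (intro exI[of _ "ps @ map (\<lambda>(p, q). (- p, q)) qs"])
      (auto simp add: comult_simps o_def case_prod_unfold simp del: mult_minus_right)
next
  case (6 u v)
  then obtain ps qs where ps: "set ps \<subseteq> UZ \<times> UZ"
      "\<And>\<beta> a b. bilinear \<beta> \<Longrightarrow> comult u \<beta> (a, b) = (\<Sum>(p, q)\<leftarrow>ps. \<beta> (a * p, b * q))"
    and qs: "set qs \<subseteq> UZ \<times> UZ"
      "\<And>\<beta> a b. bilinear \<beta> \<Longrightarrow> comult v \<beta> (a, b) = (\<Sum>(p, q)\<leftarrow>qs. \<beta> (a * p, b * q))"
    by metis
  have "comult (u * v) \<beta> (a, b) =
      (\<Sum>(p, q)\<leftarrow>concat (map (\<lambda>(p, q). map (\<lambda>(p', q'). (p * p', q * q')) qs) ps). \<beta> (a * p, b * q))"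
    if "bilinear \<beta>" for \<beta> a b
  proof -
    have "comult (u * v) \<beta> (a, b) = (\<Sum>(p, q)\<leftarrow>ps. comult v \<beta> (a * p, b * q))"
      using that ps(2)[OF comult_simps(1)[OF that]] by (simp add: comult_simps)
    also have "\<dots> = (\<Sum>(p, q)\<leftarrow>concat (map (\<lambda>(p, q). map (\<lambda>(p', q'). (p * p', q * q')) qs) ps). \<beta> (a * p, b * q))"
      by (induction ps) (auto simp: qs(2)[OF that] o_def case_prod_unfold mult.assoc)
    finally show ?thesis .
  qed
  moreover have "set (concat (map (\<lambda>(p, q). map (\<lambda>(p', q'). (p * p', q * q')) qs) ps)) \<subseteq> UZ \<times> UZ"
  proof (rule subrelI)
    fix r s assume "(r, s) \<in> set (concat (map (\<lambda>(p, q). map (\<lambda>(p', q'). (p * p', q * q')) qs) ps))"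
    then obtain p q p' q' where "(p, q) \<in> set ps" "(p', q') \<in> set qs" "r = p * p'" "s = q * q'"
      by auto
    then show "(r, s) \<in> UZ \<times> UZ" using ps(1) qs(1) int_env.intros(6) by blast
  qed
  ultimately show ?case by blast
qed

text \<open>The value of f \<otimes> h at the coproduct of \<open>u\<close>: the base point
  \<open>(1, 1)\<close> turns right multiplication into evaluation.\<close>

definition conv :: "('u \<Rightarrow> complex) \<Rightarrow> ('u \<Rightarrow> complex) \<Rightarrow> 'u \<Rightarrow> complex" where
  "conv f h u = comult u (\<lambda>(a, b). f a * h b) (1, 1)"

lemma bilinear_product: "functional f \<Longrightarrow> functional h \<Longrightarrow> bilinear (\<lambda>(a, b). f a * h b)"
  by (simp add: bilinear_def functional_def algebra_simps)

lemma functional_conv: "functional f \<Longrightarrow> functional h \<Longrightarrow> functional (conv f h)"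
  by (simp add: functional_def[of "conv f h"] conv_def comult_simps bilinear_product fun_scale_def)

lemma conv_prod_list:
  "functional f \<Longrightarrow> functional h \<Longrightarrow> conv f h (prod_list (map (incl U) xs)) =
    (\<Sum>(p, q)\<leftarrow>splits xs. f (prod_list (map (incl U) p)) * h (prod_list (map (incl U) q)))"
  by (simp add: conv_def comult_prod_list bilinear_product)

text \<open>\<open>conv_list l [b\<^sub>1, \<dots>, b\<^sub>n]\<close> reads off the coefficient of \<open>b\<^sub>1 \<cdots> b\<^sub>n\<close> in the leading term of
  an element of filtration \<open>n\<close>, if \<open>l b\<close> is dual to \<open>b\<close>.\<close>

primrec conv_list :: "('g \<Rightarrow> 'u \<Rightarrow> complex) \<Rightarrow> 'g list \<Rightarrow> 'u \<Rightarrow> complex" where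
  "conv_list l [] = augmentation"
| "conv_list l (b # bs) = conv (l b) (conv_list l bs)"

lemma functional_conv_list: "(\<And>b. functional (l b)) \<Longrightarrow> functional (conv_list l bs)"
  by (induction bs) (auto intro: functional_conv functional_augmentation)

text \<open>The convolution evaluates the functionals only at the tensor factors of an iterated
  coproduct, finitely many elements of \<open>UZ\<close>. The set \<open>F\<close> is fixed before
  \<open>l\<close>, so that \<open>l\<close> can be chosen integral on it.\<close>

lemma conv_list_integral:
  "u \<in> UZ \<Longrightarrow> \<exists>F. finite F \<and> F \<subseteq> UZ \<and>
    (\<forall>l. (\<forall>b. functional (l b)) \<longrightarrow> (\<forall>b. l b ` F \<subseteq> \<int>) \<longrightarrow> conv_list l bs u \<in> \<int>)"
proof (induction bs arbitrary: u)
  case Nil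
  then show ?case by (intro exI[of _ "{}"]) (simp add: augmentation_UZ)
next
  case (Cons b bs)
  obtain ps where ps: "set ps \<subseteq> UZ \<times> UZ"
      "\<And>\<beta> a b. bilinear \<beta> \<Longrightarrow> comult u \<beta> (a, b) = (\<Sum>(p, q)\<leftarrow>ps. \<beta> (a * p, b * q))"
    using comult_UZ[OF Cons.prems] by metis
  obtain F where F: "\<And>q. q \<in> UZ \<Longrightarrow> finite (F q) \<and> F q \<subseteq> UZ \<and>
    (\<forall>l. (\<forall>b. functional (l b)) \<longrightarrow> (\<forall>b. l b ` F q \<subseteq> \<int>) \<longrightarrow> conv_list l bs q \<in> \<int>)"
    using Cons.IH by metis
  \<comment> \<open>The left factors are arguments of \<open>l b\<close>; each right factor brings
    the set belonging to the rest of the list.\<close>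
  let ?F = "fst ` set ps \<union> (\<Union>q\<in>snd ` set ps. F q)"
  have "conv_list l (b # bs) u \<in> \<int>" if l: "\<forall>b. functional (l b)" "\<forall>b. l b ` ?F \<subseteq> \<int>" for l
  proof -
    have "conv_list l (b # bs) u = (\<Sum>(p, q)\<leftarrow>ps. l b p * conv_list l bs q)"
      using l(1) by (simp add: conv_def ps(2) bilinear_product functional_conv_list)
    moreover have "l b p * conv_list l bs q \<in> \<int>" if "(p, q) \<in> set ps" for p q
    proof -
      have "l b p \<in> \<int>" using l(2) that by force
      moreover have "conv_list l bs q \<in> \<int>"
      proof -
        have "F q \<subseteq> ?F" "q \<in> UZ" using that ps(1) by force+
        then show ?thesis using F[of q] l by (meson image_mono order_trans)
      qed
      ultimately show ?thesis by (rule Ints_mult)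
    qed
    then have "(\<Sum>(p, q)\<leftarrow>ps. l b p * conv_list l bs q) \<in> \<int>"
      by (induction ps) (auto intro!: Ints_add)
    ultimately show ?thesis by simp
  qed
  moreover have sub: "fst ` set ps \<subseteq> UZ" "snd ` set ps \<subseteq> UZ" using ps(1) by auto
  have "finite ?F" using F sub(2) by blast
  moreover have "?F \<subseteq> UZ" using F sub by blast
  ultimately show ?case by blast
qed

end

text \<open>The number of permutations of the positions that fix a word with multiset
  \<open>M\<close>; this is the permanent that arises for dual functionals.\<close>

definition mfact :: "'a multiset \<Rightarrow> nat" where
  "mfact M = (\<Prod>x\<in>set_mset M. fact (count M x))"

lemma mfact_add_mset: "mfact (add_mset b M) = (count M b + 1) * mfact M"
proof (cases "b \<in># M")
  case True
  then have "mfact (add_mset b M) = fact (Suc (count M b)) * (\<Prod>x\<in>set_mset M - {b}. fact (count (add_mset b M) x))"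
    by (simp add: mfact_def insert_absorb prod.remove[of _ b])
  also have "(\<Prod>x\<in>set_mset M - {b}. fact (count (add_mset b M) x)) = (\<Prod>x\<in>set_mset M - {b}. fact (count M x))"
    by (rule prod.cong) auto
  finally show ?thesis using True
    by (simp add: mfact_def prod.remove[of "set_mset M" b] algebra_simps)
next
  case False
  then have "(\<Prod>x\<in>set_mset M. fact (count (add_mset b M) x)) = mfact M"
    unfolding mfact_def by (intro prod.cong) auto
  then show ?thesis using False by (simp add: mfact_def not_in_iff)
qed

lemma mfact_pos: "mfact M > 0"
  by (simp add: mfact_def prod_pos)

context km_env
begin

text \<open>In the sum over splits, an empty left part is killed by \<open>l b 1 = 0\<close>, and a
  left part with at least two letters leaves too few letters for the remaining functionals. Only
  single letters on the left survive, and duality selects those equal to \<open>b\<close>.\<close>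

lemma conv_list_prod_list:
  assumes l: "\<And>b. functional (l b)" "\<And>b. l b 1 = 0"
    and dual: "\<And>b c. b \<in> B \<Longrightarrow> c \<in> B \<Longrightarrow> l b (incl U c) = of_bool (c = b)"
  shows "set bs \<subseteq> B \<Longrightarrow> set xs \<subseteq> B \<Longrightarrow> length xs \<le> length bs \<Longrightarrow>
    conv_list l bs (prod_list (map (incl U) xs)) = of_bool (mset xs = mset bs) * of_nat (mfact (mset bs))"
proof (induction bs arbitrary: xs)
  case Nil
  then show ?case by (simp add: augmentation_one mfact_def)
next
  case (Cons b bs)
  define g :: "'g multiset \<Rightarrow> complex" where "g M = of_bool (M = mset bs) * of_nat (mfact (mset bs))" for M
  have split: "l b (prod_list (map (incl U) p)) * conv_list l bs (prod_list (map (incl U) q)) =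
      (if length p = 1 then of_bool (p = [b]) * g (mset q) else 0)" if "(p, q) \<in> set (splits xs)" for p q
  proof -
    have pq: "length p + length q = length xs" "set p \<subseteq> B" "set q \<subseteq> B"
      using set_splits[OF that] Cons.prems by auto
    consider "p = []" | c where "p = [c]" | "length p \<ge> 2"
      by (cases p; cases "tl p") auto
    then show ?thesis
    proof cases
      case 1
      then show ?thesis by (simp add: l(2))
    next
      case 2
      then show ?thesis using pq Cons dual by (auto simp: g_def)
    next
      case 3
      then have "length q < length bs" using pq Cons.prems by simp
      moreover from this have "mset q \<noteq> mset bs" using mset_eq_length by (metis nat_neq_iff)
      ultimately show ?thesis using Cons pq 3 by auto
    qed
  qed
  have "conv_list l (b # bs) (prod_list (map (incl U) xs)) =
      (\<Sum>(p, q)\<leftarrow>splits xs. l b (prod_list (map (incl U) p)) * conv_list l bs (prod_list (map (incl U) q)))"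
    using l(1) by (simp add: conv_prod_list functional_conv_list)
  also have "\<dots> = (\<Sum>(p, q)\<leftarrow>splits xs. if length p = 1 then of_bool (p = [b]) * g (mset q) else 0)"
    by (rule arg_cong[of _ _ sum_list], rule map_cong[OF refl]) (use split in auto)
  also have "\<dots> = of_nat (count (mset xs) b) * g (mset xs - {#b#})"
    by (rule splits_singleton)
  also have "\<dots> = of_bool (mset xs = mset (b # bs)) * of_nat (mfact (mset (b # bs)))"
  proof (cases "b \<in># mset xs")
    case True
    then have "mset xs - {#b#} = mset bs \<longleftrightarrow> mset xs = mset (b # bs)"
      by (metis add_mset_remove_trivial insert_DiffM mset.simps(2))
    then show ?thesis by (auto simp: g_def mfact_add_mset algebra_simps)
  next
    case False
    then have "mset xs \<noteq> mset (b # bs)" by (metis mset.simps(2) union_single_eq_member)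
    then show ?thesis using False by (simp add: not_in_iff)
  qed
  finally show ?case .
qed

end

section \<open>Pure subgroups and dual functionals\<close>

text \<open>A minimal set of generators modulo \<open>H\<close> is independent modulo \<open>H\<close>: a nontrivial relation with
  \<open>\<Sum>\<bar>a f\<bar>\<close> minimal has, by the Euclidean algorithm, a single nonzero coefficient, and then purity
  makes one generator superfluous.\<close>

lemma independent_generators_modulo_pure:
  fixes H M F :: "'a::ab_group_add set"
  assumes H: "zmod.subspace H" and M: "zmod.subspace M" and HM: "H \<subseteq> M"
    and pure: "\<And>k x. k \<noteq> 0 \<Longrightarrow> x \<in> M \<Longrightarrow> zmul k x \<in> H \<Longrightarrow> x \<in> H"
    and F: "finite F" "F \<subseteq> M"
  obtains F' where "finite F'" "F' \<subseteq> M" "F \<subseteq> zmod.span (H \<union> F')"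
    "\<And>a f. (\<Sum>f\<in>F'. zmul (a f) f) \<in> H \<Longrightarrow> f \<in> F' \<Longrightarrow> a f = 0"
proof -
  define good where "good F' \<longleftrightarrow> finite F' \<and> F' \<subseteq> M \<and> F \<subseteq> zmod.span (H \<union> F')" for F'
  have "good F" using F by (auto simp: good_def intro: zmod.span_base)
  then obtain F0 where F0: "good F0" "\<And>F'. good F' \<Longrightarrow> card F0 \<le> card F'"
    using ex_has_least_nat[of good F card] by blast
  \<comment> \<open>The generating set varies together with the relation, since a Euclidean step
    exchanges a generator; only its minimal size is fixed.\<close>
  define rel where "rel = (\<lambda>(F', a). good F' \<and> card F' = card F0 \<and> (\<Sum>f\<in>F'. zmul (a f) f) \<in> H \<and>
    (\<exists>f\<in>F'. a f \<noteq> 0))"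
  define wt :: "'a set \<times> ('a \<Rightarrow> int) \<Rightarrow> nat" where "wt = (\<lambda>(F', a). nat (\<Sum>f\<in>F'. \<bar>a f\<bar>))"
  have replace: "good F''" if "good F'" "finite F''" "F'' \<subseteq> M" "F' \<subseteq> zmod.span (H \<union> F'')" for F' F''
  proof -
    have "zmod.span (H \<union> F') \<subseteq> zmod.span (H \<union> F'')"
      using that by (intro zmod.span_minimal) (auto intro: zmod.span_base)
    then show ?thesis using that by (auto simp: good_def)
  qed
  have "\<not> rel p" for p
  proof
    assume "rel p"
    then obtain p where p: "rel p" "\<And>q. rel q \<Longrightarrow> wt p \<le> wt q"
      using ex_has_least_nat[of rel p wt] by blast
    obtain E a where Ea: "p = (E, a)" by force
    have E: "finite E" "E \<subseteq> M" "good E" "card E = card F0" and sum: "(\<Sum>f\<in>E. zmul (a f) f) \<in> H"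
      using p(1) by (auto simp: rel_def Ea good_def)
    obtain f where f: "f \<in> E" "a f \<noteq> 0" using p(1) by (auto simp: rel_def Ea)
    show False
    proof (cases "\<forall>g\<in>E. a g \<noteq> 0 \<longrightarrow> g = f")
      case True
      then have "\<forall>g\<in>E - {f}. zmul (a g) g = 0"
        by (metis DiffE insertI1 zmod.scale_zero_left)
      then have "(\<Sum>f\<in>E. zmul (a f) f) = zmul (a f) f"
        by (simp only: sum.remove[OF E(1) f(1)] sum.neutral add_0_right)
      then have "zmul (a f) f \<in> H" using sum by simp
      then have "f \<in> H" using pure f E(2) by blast
      then have "good (E - {f})"
        using E by (intro replace[OF E(3)]) (auto intro: zmod.span_base)
      then show False using F0(2)[of "E - {f}"] E f by (metis card_Diff1_less leD)
    next
      case False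
      then obtain f1 f2 where f12: "f1 \<in> E" "f2 \<in> E" "f1 \<noteq> f2" "a f2 \<noteq> 0" "\<bar>a f1\<bar> \<ge> \<bar>a f2\<bar>"
        using f by (metis linorder_le_cases)
      \<comment> \<open>With this sign, subtracting \<open>s * a f2\<close> lowers the absolute
        value of \<open>a f1\<close> by that of \<open>a f2\<close>.\<close>
      define s where "s = sgn (a f1) * sgn (a f2)"
      have s: "\<bar>a f1 - s * a f2\<bar> < \<bar>a f1\<bar>"
        using f12(4,5) by (auto simp: s_def sgn_if abs_if split: if_splits)
      \<comment> \<open>Exchanging \<open>f2\<close> for \<open>h\<close> leaves the sum unchanged:
        \<open>zmul (a f2) h\<close> restores the multiple of \<open>f1\<close> that was
        subtracted.\<close>
      define h where "h = f2 + zmul s f1"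
      define E' where "E' = insert h (E - {f2})"
      have h: "h \<in> M" using f12 E M by (auto simp: h_def intro!: zmod.subspace_add zmod.subspace_scale)
      have "f2 = h - zmul s f1" by (simp add: h_def)
      moreover have "h - zmul s f1 \<in> zmod.span (H \<union> E')"
        using f12 by (intro zmod.span_diff zmod.span_scale) (auto intro!: zmod.span_base simp: E'_def)
      ultimately have good: "good E'"
        using E h by (intro replace[OF E(3)]) (auto simp: E'_def intro: zmod.span_base)
      \<comment> \<open>If \<open>h\<close> were already a generator, the new set would be smaller
        than the minimal size allows.\<close>
      have h_new: "h \<notin> E - {f2}"
      proof
        assume "h \<in> E - {f2}"
        then have "E' = E - {f2}" by (simp only: E'_def insert_absorb)
        then have "card E' < card E" using card_Diff1_less[OF E(1) f12(2)] by (simp only:)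
        then show False using F0(2)[OF good] E by simp
      qed
      define R where "R = E - {f2} - {f1}"
      have R: "f1 \<notin> R" "h \<notin> R" "finite R" "h \<noteq> f1" "f2 \<notin> R"
        using h_new E f12 by (auto simp: R_def)
      have E_eq: "E = insert f1 (insert f2 R)" and E'_eq: "E' = insert f1 (insert h R)"
        using f12 by (auto simp: R_def E'_def)
      define a' where "a' = a(f1 := a f1 - s * a f2, h := a f2)"
      have a'R: "(\<Sum>f\<in>R. zmul (a' f) f) = (\<Sum>f\<in>R. zmul (a f) f)" "(\<Sum>f\<in>R. \<bar>a' f\<bar>) = (\<Sum>f\<in>R. \<bar>a f\<bar>)"
        using R by (auto simp: a'_def intro!: sum.cong)
      have a'v: "a' f1 = a f1 - s * a f2" "a' h = a f2" using R by (auto simp: a'_def)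
      have "(\<Sum>f\<in>E'. zmul (a' f) f) = zmul (a f1 - s * a f2) f1 + (zmul (a f2) h + (\<Sum>f\<in>R. zmul (a f) f))"
        unfolding E'_eq using R by (simp add: a'R a'v)
      also have "zmul (a f2) h = zmul (a f2) f2 + zmul (s * a f2) f1"
        by (simp add: h_def zmul_add_right zmul_assoc mult.commute)
      also have "zmul (a f1 - s * a f2) f1 + (zmul (a f2) f2 + zmul (s * a f2) f1 + (\<Sum>f\<in>R. zmul (a f) f)) =
          (\<Sum>f\<in>E. zmul (a f) f)"
        unfolding E_eq using R f12 by (simp add: zmod.scale_left_diff_distrib algebra_simps)
      finally have "(\<Sum>f\<in>E'. zmul (a' f) f) \<in> H" using sum by simp
      moreover have "card E' = card E" unfolding E_eq E'_eq using R f12 by simp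
      moreover have "a' h \<noteq> 0" "h \<in> E'" using f12 a'v by (auto simp: E'_def)
      ultimately have "rel (E', a')" using good E by (auto simp: rel_def)
      then have "wt (E, a) \<le> wt (E', a')" using p by (simp add: Ea)
      moreover have "(\<Sum>f\<in>E'. \<bar>a' f\<bar>) < (\<Sum>f\<in>E. \<bar>a f\<bar>)"
        unfolding E_eq E'_eq using R f12 s by (simp add: a'R a'v)
      moreover have "0 \<le> (\<Sum>f\<in>E'. \<bar>a' f\<bar>)" by (simp add: sum_nonneg)
      ultimately show False unfolding wt_def prod.case by linarith
    qed
  qed
  then have "a f = 0" if "(\<Sum>f\<in>F0. zmul (a f) f) \<in> H" "f \<in> F0" for a f
    using that F0(1) unfolding rel_def by blast
  then show thesis using that F0(1) unfolding good_def by blast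
qed

context km_env
begin

section \<open>The integral forms as abelian groups\<close>

lemma UZ_zmul: "u \<in> UZ \<Longrightarrow> zmul k u \<in> UZ"
proof (induction k rule: int_induct[where k = 0])
  case (step1 i)
  then show ?case by (simp add: zmul_succ UZ_add)
next
  case (step2 i)
  then show ?case using zmul_succ[of "i - 1" u] int_env.intros(5)[of "zmul i u" S G U u]
    by (simp add: eq_diff_eq)
qed (simp add: UZ_zero)

lemma subspace_UZ: "zmod.subspace UZ"
  by (simp add: zmod.subspace_def UZ_zero UZ_add UZ_zmul)

lemma divpow_one: "divpow U u 1 = u"
  by (simp add: divpow_def)

lemma env_binomial_one: "env_binomial U u 1 = u"
  by (simp add: env_binomial_def)

lemma gZ_bracket: "x \<in> gZ \<Longrightarrow> y \<in> gZ \<Longrightarrow> lbracket G x y \<in> gZ"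
  by (simp add: int_lie_def incl_bracket int_env.intros)

text \<open>The generators are their own first divided powers or binomials, hence integral, and
  \<open>gZ\<close> is closed under brackets.\<close>

lemma span_gZ: "L.span gZ = UNIV"
proof -
  define \<gamma> :: "('i, 'y) km_gen \<Rightarrow> 'g" where "\<gamma> = case_km_gen (gen_e G) (gen_f G) (gen_h G)"
  define X :: "('i, 'y) km_gen set" where "X = GenE ` index S \<union> GenF ` index S \<union> range GenH"
  have gen: "\<gamma> x \<in> gZ" if "x \<in> X" for x
    using that int_env.intros(1)[of _ S U G 1] int_env.intros(2)[of _ S U G 1] int_env.intros(3)[of U G _ 1 S]
    by (auto simp: X_def \<gamma>_def int_lie_def divpow_one env_binomial_one simp del: One_nat_def)
  have bracket: "lbracket G x y \<in> L.span gZ" if x: "x \<in> L.span gZ" and y: "y \<in> L.span gZ" for x y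
    using x
  proof (induction rule: L.span_induct_alt)
    case base
    show ?case using L.bracket_scale_left[of 0 0 y] by (simp add: L.span_zero)
  next
    case (step c x z)
    have "lbracket G x y \<in> L.span gZ"
      using y
    proof (induction rule: L.span_induct_alt)
      case base
      show ?case using L.bracket_scale_right[of x 0 0] by (simp add: L.span_zero)
    next
      case (step d y z')
      moreover have "lbracket G x y \<in> L.span gZ"
        using \<open>x \<in> gZ\<close> step(1) by (intro L.span_base gZ_bracket)
      ultimately show ?case
        by (auto simp: L.bracket_add_right L.bracket_scale_right intro!: L.span_add L.span_scale)
    qed
    then show ?case using step
      by (auto simp: L.bracket_add_left L.bracket_scale_left intro!: L.span_add L.span_scale)
  qed
  have "lie_eval (lscale G) (lbracket G) \<gamma> t \<in> L.span gZ" if "set_lie_term t \<subseteq> X" for t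
    using that by (induction t) (auto intro: L.span_base gen L.span_zero L.span_add L.span_scale bracket)
  moreover have "\<exists>t. set_lie_term t \<subseteq> X \<and> lie_eval (lscale G) (lbracket G) \<gamma> t = x" for x
    using km by (simp add: kac_moody_algebra_def lie_presentation_def X_def \<gamma>_def)
  ultimately show ?thesis by (metis UNIV_eq_I)
qed

text \<open>The kernel is a divisible subgroup of the free abelian group \<open>gZ\<close>.\<close>

lemma inj_incl:
  assumes "Z_basis B gZ"
  shows "inj (incl U)"
proof -
  have B: "\<not> zmod.dependent B" "zmod.span B = gZ" using assms by (auto simp: Z_basis_def)
  have "x = 0" if x: "incl U x = 0" for x
  proof (rule ccontr)
    assume "x \<noteq> 0"
    have gZ: "lscale G c x \<in> gZ" for c by (simp add: int_lie_def incl_scale x UZ_zero)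
    define r where "r = zmod.representation B x"
    have "x \<in> gZ" using gZ[of 1] by simp
    then have "(\<Sum>b | r b \<noteq> 0. zmul (r b) b) = x"
      using B by (simp add: r_def zmod.sum_nonzero_representation_eq)
    with \<open>x \<noteq> 0\<close> obtain b where b: "r b \<noteq> 0" by fastforce
    \<comment> \<open>The coefficients of a multiple of \<open>m\<close> are multiples of
      \<open>m\<close>, which a nonzero integer of absolute value below \<open>m\<close> is
      not.\<close>
    define m where "m = \<bar>r b\<bar> + 1"
    define y where "y = lscale G (1 / of_int m) x"
    have "m > 0" by (simp add: m_def)
    then have "x = zmul m y" by (simp add: y_def zmul_lie)
    then have "r b = m * zmod.representation B y b"
      using zmod.representation_scale[OF B(1), of y m] gZ B by (simp add: r_def y_def)
    moreover from this b have "1 \<le> \<bar>zmod.representation B y b\<bar>" by auto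
    ultimately have "\<bar>r b\<bar> \<ge> m" using \<open>m > 0\<close>
      by (simp add: abs_mult)
    then show False by (simp add: m_def)
  qed
  then show ?thesis by (metis injI incl_diff right_minus_eq)
qed

lemma module_hom_incl: "module_hom zmul zmul (incl U)"
  by unfold_locales (simp_all add: incl_add incl_zmul)

section \<open>Rational independence and dual functionals\<close>

abbreviation rat_scale :: "rat \<Rightarrow> 'u \<Rightarrow> 'u" where
  "rat_scale q \<equiv> ascale U (of_rat q)"

lemma vector_space_rat_scale: "vector_space rat_scale"
  by unfold_locales (auto simp: A.scale_left_distrib A.scale_right_distrib of_rat_add of_rat_mult)

text \<open>Multiplication by the product of the denominators turns a rational relation into an
  integral one.\<close>

lemma rat_independent:
  assumes T: "\<not> zmod.dependent T"
  shows "\<not> module.dependent rat_scale T"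
proof -
  interpret Q: vector_space rat_scale by (rule vector_space_rat_scale)
  show ?thesis
    unfolding Q.independent_explicit_module
  proof (intro allI impI)
    fix t q v assume t: "finite t" "t \<subseteq> T" "(\<Sum>v\<in>t. rat_scale (q v) v) = 0" "v \<in> t"
    define m where "m = (\<Prod>v\<in>t. snd (quotient_of (q v)))"
    have m: "m \<noteq> 0" using quotient_of_denom_pos' t(1) by (auto simp: m_def) (metis less_irrefl)
    have "\<exists>k. of_int m * q v = of_int k" if "v \<in> t" for v
    proof -
      have "m = snd (quotient_of (q v)) * (\<Prod>w\<in>t - {v}. snd (quotient_of (q w)))"
        using t(1) that by (simp add: m_def prod.remove)
      moreover have "of_int (snd (quotient_of (q v))) * q v = of_int (fst (quotient_of (q v)))"
        using quotient_of_denom_pos'[of "q v"] quotient_of_div[of "q v"]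
        by (cases "quotient_of (q v)") (auto simp: field_simps)
      ultimately have "of_int m * q v = of_int (fst (quotient_of (q v)) * (\<Prod>w\<in>t - {v}. snd (quotient_of (q w))))"
        by (simp add: mult_ac)
      then show ?thesis by blast
    qed
    then obtain k where k: "\<And>v. v \<in> t \<Longrightarrow> of_int m * q v = of_int (k v)" by metis
    have "zmul (k v) v = rat_scale (of_int m) (rat_scale (q v) v)" if "v \<in> t" for v
    proof -
      have "rat_scale (of_int m) (rat_scale (q v) v) = ascale U (of_rat (of_int m * q v)) v"
        by (simp only: A.scale_scale of_rat_mult)
      then show ?thesis by (simp only: k[OF that] of_rat_of_int_eq zmul_env)
    qed
    then have "(\<Sum>v\<in>t. zmul (k v) v) = rat_scale (of_int m) (\<Sum>v\<in>t. rat_scale (q v) v)"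
      by (simp add: A.scale_sum_right)
    then have "k v = 0" using zmod.independentD[OF T t(1,2) _ t(4)] t(3) by simp
    then show "q v = 0" using k[OF t(4)] m by simp
  qed
qed

lemma dual_functional:
  assumes B: "Z_basis B gZ" and F: "finite F" "F \<subseteq> UZ" and b: "b \<in> B"
  obtains l where "functional l" "l 1 = 0" "\<And>c. c \<in> B \<Longrightarrow> l (incl U c) = of_bool (c = b)" "l ` F \<subseteq> \<int>"
proof -
  note inj = inj_incl[OF B]
  note aug = functional_additive[OF functional_augmentation]
  have indB: "\<not> zmod.dependent B" and spanB: "zmod.span B = gZ" using B by (auto simp: Z_basis_def)
  have ind: "\<not> zmod.dependent (incl U ` B)"
    using module_hom.independent_injective_image[OF module_hom_incl indB] inj by (simp add: inj_on_def)
  have span: "zmod.span (incl U ` B) = incl U ` gZ"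
    using module_hom.span_image[OF module_hom_incl, of B] spanB by simp
  define H where "H = zmod.span (insert 1 (incl U ` B))"
  have H_iff: "u \<in> H \<longleftrightarrow> (\<exists>k. u - zmul k 1 \<in> incl U ` gZ)" for u
    by (simp add: H_def zmod.span_insert span)
  have BH: "insert 1 (incl U ` B) \<subseteq> H" by (simp add: H_def zmod.span_superset)
  have "incl U ` B \<subseteq> UZ" using spanB zmod.span_superset[of B] by (auto simp: int_lie_def)
  then have BU: "insert 1 (incl U ` B) \<subseteq> UZ" by (simp add: int_env.intros)
  have HU: "H \<subseteq> UZ" unfolding H_def by (rule zmod.span_minimal[OF BU subspace_UZ])
  \<comment> \<open>If k u = m + x with x a Lie element, the augmentation gives m = k n, where n is
    that of u. Then u - n is x / k, a Lie element which lies in \<open>UZ\<close>.\<close>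
  have pure: "u \<in> H" if "k \<noteq> 0" "u \<in> UZ" and kH: "zmul k u \<in> H" for k u
  proof -
    obtain m x where mx: "zmul k u - zmul m 1 = incl U x" using kH by (auto simp: H_iff)
    obtain n where n: "augmentation u = of_int n" using augmentation_UZ[OF \<open>u \<in> UZ\<close>] by (auto elim: Ints_cases)
    have "of_int (k * n) - of_int m = augmentation (zmul k u - zmul m 1)"
      by (simp add: additive.diff[OF aug] functional_zmul[OF functional_augmentation] n augmentation_one)
    also have "\<dots> = 0" by (simp add: mx augmentation_incl)
    finally have "m = k * n" by (simp del: of_int_mult)
    then have "zmul k (u - zmul n 1) = incl U x"
      using mx by (simp add: zmod.scale_right_diff_distrib zmul_assoc)
    then have "u - zmul n 1 = incl U (lscale G (1 / of_int k) x)"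
      using \<open>k \<noteq> 0\<close> by (simp add: incl_scale zmul_env flip: incl_zmul)
        (metis A.scale_one A.scale_scale divide_self_if mult.commute of_int_eq_0_iff times_divide_eq_right mult.right_neutral)
    moreover have "u - zmul n 1 \<in> UZ" using that by (intro int_env.intros UZ_zmul)
    ultimately have "u - zmul n 1 \<in> incl U ` gZ" by (auto simp: int_lie_def)
    then show ?thesis by (auto simp: H_iff)
  qed
  have subH: "zmod.subspace H" by (simp add: H_def)
  obtain F' where F': "finite F'" "F' \<subseteq> UZ" "F \<subseteq> zmod.span (H \<union> F')"
    "\<And>a f. (\<Sum>f\<in>F'. zmul (a f) f) \<in> H \<Longrightarrow> f \<in> F' \<Longrightarrow> a f = 0"
    by (rule independent_generators_modulo_pure[OF subH subspace_UZ HU pure F]) (assumption | rule that)+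
  have disj: "f \<notin> H" if "f \<in> F'" for f
  proof
    assume "f \<in> H"
    have "(\<Sum>g\<in>F'. zmul (of_bool (g = f)) g) = (\<Sum>g\<in>F'. if g = f then f else 0)"
      by (rule sum.cong) auto
    also have "\<dots> = f" using that F'(1) by simp
    finally have "(\<Sum>g\<in>F'. zmul (of_bool (g = f)) g) \<in> H" using \<open>f \<in> H\<close> by simp
    from F'(4)[OF this that] show False by simp
  qed
  define T where "T = insert 1 (incl U ` B) \<union> F'"
  \<comment> \<open>A relation loses its coefficients in three stages: on \<open>F'\<close> by
    independence modulo \<open>H\<close>, at \<open>1\<close> by the augmentation, and on the rest
    by independence of the basis.\<close>
  have indT: "\<not> zmod.dependent T"
    unfolding zmod.independent_explicit_module
  proof (intro allI impI)
    fix t k v assume t: "finite t" "t \<subseteq> T" "(\<Sum>v\<in>t. zmul (k v) v) = 0" "v \<in> t"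
    define k' where "k' v = (if v \<in> t then k v else 0)" for v
    have split: "(\<Sum>v\<in>t. zmul (k v) v) = (\<Sum>v\<in>t - F'. zmul (k v) v) + (\<Sum>v\<in>F'. zmul (k' v) v)"
    proof -
      have "(\<Sum>v\<in>F'. zmul (k' v) v) = (\<Sum>v\<in>t \<inter> F'. zmul (k v) v)"
        using F'(1) by (intro sum.mono_neutral_cong_right) (auto simp: k'_def)
      then show ?thesis
        using sum.Int_Diff[OF t(1), of "\<lambda>v. zmul (k v) v" F'] by (simp only: add.commute)
    qed
    have tH: "t - F' \<subseteq> insert 1 (incl U ` B)" using t(2) by (auto simp: T_def)
    have "(\<Sum>v\<in>t - F'. zmul (k v) v) \<in> H"
      using tH BH subH by (intro zmod.subspace_sum[OF subH] zmod.subspace_scale[OF subH]) auto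
    then have "(\<Sum>v\<in>F'. zmul (k' v) v) \<in> H"
      using split t(3) zmod.subspace_neg[OF subH] by (metis add_eq_0_iff2 minus_minus)
    then have k'0: "k' v = 0" if "v \<in> F'" for v using F'(4) that by blast
    then have 0: "(\<Sum>v\<in>t - F'. zmul (k v) v) = 0" using split t(3) by simp
    have aug0: "augmentation (zmul (k v) v) = 0" if "v \<in> t - F'" "v \<noteq> 1" for v
      using that tH by (auto simp: functional_zmul[OF functional_augmentation] augmentation_incl)
    have k1: "k 1 = 0" if "1 \<in> t - F'"
    proof -
      have "0 = augmentation (\<Sum>v\<in>t - F'. zmul (k v) v)" by (simp add: 0 additive.zero[OF aug])
      also have "\<dots> = (\<Sum>v\<in>t - F'. augmentation (zmul (k v) v))" by (rule additive.sum[OF aug])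
      also have "\<dots> = augmentation (zmul (k 1) 1)"
        using that t(1) aug0 by (subst sum.remove[of _ 1]) (auto intro!: sum.neutral)
      finally show ?thesis by (simp add: functional_zmul[OF functional_augmentation] augmentation_one)
    qed
    have "(\<Sum>v\<in>t - F' - {1}. zmul (k v) v) = (\<Sum>v\<in>t - F'. zmul (k v) v)"
      using t(1) k1 by (intro sum.mono_neutral_left) auto
    then have kB: "k v = 0" if "v \<in> t - F' - {1}" for v
      using zmod.independentD[OF ind, of "t - F' - {1}" k v] t(1) tH that 0 by auto
    show "k v = 0"
      using k'0[of v] k1 kB[of v] t(4) by (cases "v \<in> F'"; cases "v = 1") (auto simp: k'_def)
  qed
  \<comment> \<open>The linear extension takes place over the rationals, to which independence over
    the integers passes.\<close>
  interpret Q: vector_space_pair rat_scale "\<lambda>q z :: complex. of_rat q * z"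
    by (intro vector_space_pair.intro vector_space_rat_scale)
      (unfold_locales, auto simp: algebra_simps of_rat_add of_rat_mult)
  obtain f where f: "Vector_Spaces.linear rat_scale (\<lambda>q z :: complex. of_rat q * z) f"
    "\<And>u. u \<in> T \<Longrightarrow> f u = of_bool (u = incl U b)"
    using Q.linear_independent_extend[OF rat_independent[OF indT], of "\<lambda>u. of_bool (u = incl U b)"] by blast
  have add: "additive f"
    using f(1) by (simp add: additive_def Vector_Spaces.linear_def module_hom_def module_hom_axioms_def)
  obtain l where l: "functional l" "\<And>u. u \<in> UZ \<Longrightarrow> l u = f u" using linearization[OF add] by metis
  have TU: "T \<subseteq> UZ" using BU F' by (auto simp: T_def)
  have "l u \<in> \<int>" if "u \<in> zmod.span T" for u
    using that
  proof (induction rule: zmod.span_induct_alt)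
    case base
    show ?case by (simp add: additive.zero[OF functional_additive[OF l(1)]])
  next
    case (step k v w)
    then have "l v \<in> \<int>" using TU by (auto simp: l(2) f(2) subset_iff)
    then show ?case using step
      by (simp add: additive.add[OF functional_additive[OF l(1)]] functional_zmul[OF l(1)])
  qed
  moreover have "zmod.span (H \<union> F') \<subseteq> zmod.span T"
    unfolding H_def T_def
    by (intro zmod.span_minimal Un_least zmod.span_mono) (auto intro: zmod.span_base)
  ultimately have "l ` F \<subseteq> \<int>" using F'(3) by blast
  moreover have "l 1 = 0"
  proof -
    have "1 \<noteq> incl U b" using augmentation_one augmentation_incl by (metis zero_neq_one)
    then show ?thesis using l(2) f(2) by (simp add: T_def int_env.intros)
  qed
  moreover have "l (incl U c) = of_bool (c = b)" if "c \<in> B" for c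
  proof -
    have "incl U c \<in> T" using that by (simp add: T_def)
    then show ?thesis using l(2) f(2) TU inj by (auto simp: inj_eq)
  qed
  ultimately show thesis using that l(1) by blast
qed

lemma dual_functionals:
  assumes B: "Z_basis B gZ" and F: "finite F" "F \<subseteq> UZ"
  obtains l where "\<And>b. functional (l b)" "\<And>b. l b 1 = 0"
    "\<And>b c. b \<in> B \<Longrightarrow> c \<in> B \<Longrightarrow> l b (incl U c) = of_bool (c = b)" "\<And>b. l b ` F \<subseteq> \<int>"
proof -
  have "\<exists>l. functional l \<and> l 1 = 0 \<and> (b \<in> B \<longrightarrow> (\<forall>c\<in>B. l (incl U c) = of_bool (c = b))) \<and> l ` F \<subseteq> \<int>" for b
  proof (cases "b \<in> B")
    case True
    then show ?thesis using dual_functional[OF B F] by metis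
  next
    case False
    \<comment> \<open>The zero functional serves as default outside \<open>B\<close>.\<close>
    then show ?thesis by (intro exI[of _ "\<lambda>u. 0"]) (auto simp: functional_def)
  qed
  then show thesis using that by metis
qed

end

section \<open>Ordered lists\<close>

lemma sorted_distinct_unique:
  assumes "linear_order_on B r" "set xs \<subseteq> B" "distinct xs" "distinct ys" "set xs = set ys"
    and "sorted_wrt (\<lambda>x y. (x, y) \<in> r) xs" "sorted_wrt (\<lambda>x y. (x, y) \<in> r) ys"
  shows "xs = ys"
  using assms(2-)
proof (induction xs arbitrary: ys)
  case (Cons x xs)
  then obtain y ys' where ys: "ys = y # ys'" by (cases ys) auto
  have "x = y"
  proof (rule ccontr)
    assume "x \<noteq> y"
    then have "y \<in> set xs" "x \<in> set ys'" using Cons.prems ys by auto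
    then have "(x, y) \<in> r" "(y, x) \<in> r" using Cons.prems ys by auto
    with \<open>x \<noteq> y\<close> show False
      using assms(1) by (auto simp: linear_order_on_def partial_order_on_def antisym_def)
  qed
  moreover from this have "set xs = set ys'" using Cons.prems ys by (metis Diff_insert_absorb distinct.simps(2) list.simps(15))
  ultimately show ?case using Cons ys by auto
qed simp

lemma ex_sorted_distinct:
  assumes r: "linear_order_on B r"
  shows "finite X \<Longrightarrow> X \<subseteq> B \<Longrightarrow> \<exists>xs. distinct xs \<and> set xs = X \<and> sorted_wrt (\<lambda>x y. (x, y) \<in> r) xs"
proof (induction X rule: finite_psubset_induct)
  case (psubset X)
  have min: "\<exists>m\<in>Y. \<forall>y\<in>Y. (m, y) \<in> r" if "finite Y" "Y \<noteq> {}" "Y \<subseteq> B" for Y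
    using that
  proof (induction Y rule: finite_ne_induct)
    case (singleton x)
    then show ?case
      using r by (simp add: linear_order_on_def partial_order_on_def preorder_on_def refl_on_def)
  next
    case (insert x Y)
    then obtain m where m: "m \<in> Y" "\<forall>y\<in>Y. (m, y) \<in> r" by auto
    have refl: "(x, x) \<in> r" and total: "(x, m) \<in> r \<or> (m, x) \<in> r" and trans: "trans r"
      using r insert.prems insert.hyps m
      by (auto simp: linear_order_on_def partial_order_on_def preorder_on_def refl_on_def total_on_def)
    show ?case
    proof (cases "(m, x) \<in> r")
      case True
      then show ?thesis using m by auto
    next
      case False
      then have "(x, m) \<in> r" using total by blast
      then have "\<forall>y\<in>Y. (x, y) \<in> r" using m trans by (meson transD)
      then show ?thesis using refl by auto
    qed
  qed
  show ?case
  proof (cases "X = {}")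
    case True
    then show ?thesis by (intro exI[of _ "[]"]) simp
  next
    case False
    then obtain m where m: "m \<in> X" "\<forall>y\<in>X. (m, y) \<in> r" using min psubset by metis
    then obtain xs where "distinct xs" "set xs = X - {m}" "sorted_wrt (\<lambda>x y. (x, y) \<in> r) xs"
      using psubset.IH[of "X - {m}"] psubset.prems by auto
    then show ?thesis using m by (intro exI[of _ "m # xs"]) auto
  qed
qed

text \<open>Existence and uniqueness of the increasing enumeration give the definite description its
  meaning.\<close>

lemma ordered_list:
  assumes "linear_order_on B r" "finite X" "X \<subseteq> B"
  shows "distinct (ordered_list r X)" "set (ordered_list r X) = X"
proof -
  have "\<exists>!xs. distinct xs \<and> set xs = X \<and> sorted_wrt (\<lambda>x y. (x, y) \<in> r) xs"
    using ex_sorted_distinct[OF assms] sorted_distinct_unique[OF assms(1)] assms(3) by (metis (no_types, lifting))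
  from theI'[OF this] show "distinct (ordered_list r X)" "set (ordered_list r X) = X"
    by (simp_all add: ordered_list_def)
qed

section \<open>The standard filtration\<close>

context km_env
begin

abbreviation "Fil \<equiv> filtration_less U"
abbreviation "P xs \<equiv> prod_list (map (incl U) xs)"

lemma subspace_Fil: "A.subspace (Fil n)"
  by (simp add: filtration_less_def)

lemmas Fil_add = A.subspace_add[OF subspace_Fil]
lemmas Fil_diff = A.subspace_diff[OF subspace_Fil]
lemmas Fil_scale = A.subspace_scale[OF subspace_Fil]
lemmas Fil_zero = A.subspace_0[OF subspace_Fil]

lemma P_in_Fil: "length xs < n \<Longrightarrow> P xs \<in> Fil n"
  unfolding filtration_less_def by (rule A.span_base) auto

lemma Fil_0: "Fil 0 = {0}"
  by (simp add: filtration_less_def)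

lemma Fil_mono: "m \<le> n \<Longrightarrow> Fil m \<subseteq> Fil n"
  unfolding filtration_less_def by (rule A.span_mono) auto

text \<open>At most m - 1 and at most n - 1 factors multiply to at most m + n - 2, hence fewer than
  m + n - 1; for m = 0 or n = 0 one of the two elements is zero.\<close>

lemma Fil_mult:
  assumes "u \<in> Fil m" "v \<in> Fil n"
  shows "u * v \<in> Fil (m + n - 1)"
  using assms(1) unfolding filtration_less_def[of U m]
proof (induction rule: A.span_induct_alt)
  case base
  show ?case by (simp add: Fil_zero)
next
  case (step c x y)
  then obtain xs where xs: "x = P xs" "length xs < m" by auto
  have "x * v \<in> Fil (m + n - 1)"
    using assms(2) unfolding filtration_less_def[of U n]
  proof (induction rule: A.span_induct_alt)
    case base
    show ?case by (simp add: Fil_zero)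
  next
    case (step c z w)
    then obtain zs where zs: "z = P zs" "length zs < n" by auto
    have "x * z = P (xs @ zs)" by (simp add: xs zs)
    then have "x * z \<in> Fil (m + n - 1)" using P_in_Fil[of "xs @ zs"] xs zs by simp
    then show ?case using step by (simp add: distrib_left A.scale_mult_right Fil_add Fil_scale)
  qed
  then show ?case using step by (simp add: distrib_right A.scale_mult_left Fil_add Fil_scale)
qed

lemma Fil_incl_mult:
  assumes "u \<in> Fil n"
  shows "incl U x * u \<in> Fil (Suc n)"
  using Fil_mult[OF P_in_Fil[of "[x]" 2] assms] by simp

lemma ex_Fil: "\<exists>n. u \<in> Fil n"
proof -
  have "\<exists>n. alg_eval (ascale U) (incl U) t \<in> Fil n" for t
  proof (induction t)
    case (AGen x)
    then show ?case using P_in_Fil[of "[x]" 2] by auto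
  next
    case AZero
    then show ?case by (auto intro: Fil_zero)
  next
    case AOne
    then show ?case using P_in_Fil[of "[]" 1] by auto
  next
    case (AAdd s t)
    then obtain m n where "alg_eval (ascale U) (incl U) s \<in> Fil m" "alg_eval (ascale U) (incl U) t \<in> Fil n"
      by auto
    then have "alg_eval (ascale U) (incl U) s \<in> Fil (max m n)" "alg_eval (ascale U) (incl U) t \<in> Fil (max m n)"
      using Fil_mono[of m "max m n"] Fil_mono[of n "max m n"] by auto
    then show ?case by (auto intro: Fil_add)
  next
    case (AScale c t)
    then show ?case by (auto intro: Fil_scale)
  next
    case (AMult s t)
    then show ?case by (auto intro: Fil_mult)
  qed
  then show ?thesis using env by (metis enveloping_algebra_def)
qed

text \<open>Moving \<open>x\<close> past one letter costs a bracket, that is, a product with one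
  factor fewer.\<close>

lemma P_move:
  "P (ys @ x # zs) - P (x # ys @ zs) \<in> Fil (Suc (length ys + length zs))"
proof (induction ys)
  case (Cons y ys)
  have "P (y # ys @ x # zs) - P (x # y # ys @ zs) =
      incl U y * (P (ys @ x # zs) - P (x # ys @ zs)) + P (lbracket G y x # ys @ zs)"
    by (simp add: incl_bracket algebra_simps)
  moreover have "P (lbracket G y x # ys @ zs) \<in> Fil (Suc (Suc (length ys + length zs)))"
    by (rule P_in_Fil) simp
  ultimately show ?case using Fil_incl_mult[OF Cons.IH, of y] by (simp add: Fil_add)
qed (simp add: Fil_zero)

text \<open>The associated graded algebra is commutative: sorting a word changes its product only by
  shorter products.\<close>

lemma P_mset_eq: "mset xs = mset ys \<Longrightarrow> P xs - P ys \<in> Fil (length xs)"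
proof (induction xs arbitrary: ys)
  case (Cons x xs)
  then have "x \<in> set ys" by (metis list.set_intros(1) mset_eq_setD)
  then obtain ys1 ys2 where ys: "ys = ys1 @ x # ys2" by (meson split_list)
  then have m: "mset xs = mset (ys1 @ ys2)" using Cons.prems by simp
  have len: "length xs = length ys1 + length ys2" using mset_eq_length[OF m] by simp
  have eq: "P (x # xs) - P ys = incl U x * (P xs - P (ys1 @ ys2)) - (P ys - P (x # ys1 @ ys2))"
    by (simp add: algebra_simps)
  have "P ys - P (x # ys1 @ ys2) \<in> Fil (Suc (length xs))"
    using P_move[of ys1 x ys2] by (simp add: ys len)
  from Fil_diff[OF Fil_incl_mult[OF Cons.IH[OF m], of x] this]
  show ?case by (simp only: eq length_Cons)
qed (simp add: Fil_zero)

lemma P_in_span: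
  assumes B: "L.span B = UNIV"
  shows "P xs \<in> A.span {P ys | ys. length ys = length xs \<and> set ys \<subseteq> B}"
proof (induction xs)
  case (Cons x xs)
  have *: "incl U y * P xs \<in> A.span {P ys | ys. length ys = length (x # xs) \<and> set ys \<subseteq> B}" if "y \<in> B" for y
    using Cons.IH
  proof (induction rule: A.span_induct_alt)
    case (step c z w)
    then obtain zs where "z = P zs" "length zs = length xs" "set zs \<subseteq> B" by auto
    then have "incl U y * z \<in> A.span {P ys | ys. length ys = length (x # xs) \<and> set ys \<subseteq> B}"
      using that by (intro A.span_base CollectI exI[of _ "y # zs"]) simp
    then show ?case using step
      by (simp add: distrib_left A.scale_mult_right A.span_add A.span_scale)
  qed (simp add: A.span_zero)
  have "x \<in> L.span B" by (simp add: B)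
  then have "incl U x * P xs \<in> A.span {P ys | ys. length ys = length (x # xs) \<and> set ys \<subseteq> B}"
  proof (induction rule: L.span_induct_alt)
    case (step c y z)
    then show ?case using *[OF step(1)]
      by (simp add: incl_add incl_scale distrib_right A.scale_mult_left A.span_add A.span_scale)
  qed (simp add: incl_zero A.span_zero)
  then show ?case by simp
qed (auto intro: A.span_base)

text \<open>Functionals dual to a basis can be evaluated only on words in that basis, so the
  filtration is spanned by such words; expanding the factors of a product preserves its
  length.\<close>

lemma Fil_span:
  assumes B: "L.span B = UNIV"
  shows "Fil n = A.span {P ys | ys. length ys < n \<and> set ys \<subseteq> B}"
proof (rule antisym)
  have "P xs \<in> A.span {P ys | ys. length ys < n \<and> set ys \<subseteq> B}" if "length xs < n" for xs
  proof -
    have "{P ys | ys. length ys = length xs \<and> set ys \<subseteq> B} \<subseteq> {P ys | ys. length ys < n \<and> set ys \<subseteq> B}"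
      using that by auto
    from A.span_mono[OF this] show ?thesis using P_in_span[OF B, of xs] by blast
  qed
  then show "Fil n \<subseteq> A.span {P ys | ys. length ys < n \<and> set ys \<subseteq> B}"
    unfolding filtration_less_def by (intro A.span_minimal) auto
  show "A.span {P ys | ys. length ys < n \<and> set ys \<subseteq> B} \<subseteq> Fil n"
    unfolding filtration_less_def by (intro A.span_mono) auto
qed

end

section \<open>Ordered monomials\<close>

locale km_monomials = km_env S G U
  for S :: "('i, 'y::ab_group_add) root_data"
    and G :: "('i, 'y, 'g::ab_group_add) km_data"
    and U :: "('g, 'u::ring_1) env_data" +
  fixes B :: "'g set" and r :: "('g \<times> 'g) set" and d :: "'g \<Rightarrow> nat \<Rightarrow> 'u"
  assumes basis: "Z_basis B (int_lie S G U)"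
    and order: "linear_order_on B r"
    and d_UZ: "x \<in> B \<Longrightarrow> d x n \<in> int_env S G U"
    and d_leading: "x \<in> B \<Longrightarrow> d x n - divpow U (incl U x) n \<in> filtration_less U n"
begin

definition exponents :: "('g \<Rightarrow>\<^sub>0 nat) set" where
  "exponents = {N. Poly_Mapping.keys N \<subseteq> B}"

text \<open>Up to the factor \<open>mfact\<close>, the product along this word is the leading term
  of the monomial.\<close>

definition word :: "('g \<Rightarrow>\<^sub>0 nat) \<Rightarrow> 'g list" where
  "word N = concat (map (\<lambda>x. replicate (Poly_Mapping.lookup N x) x) (ordered_list r (Poly_Mapping.keys N)))"

lemma keys_list:
  assumes "N \<in> exponents"
  shows "distinct (ordered_list r (Poly_Mapping.keys N))"
    "set (ordered_list r (Poly_Mapping.keys N)) = Poly_Mapping.keys N"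
  using ordered_list[OF order finite_keys] assms by (auto simp: exponents_def)

lemma count_concat_replicate:
  "distinct ks \<Longrightarrow> count (mset (concat (map (\<lambda>x. replicate (f x) x) ks))) y = (if y \<in> set ks then f y else 0)"
  by (induction ks) auto

lemma count_word: "N \<in> exponents \<Longrightarrow> count (mset (word N)) x = Poly_Mapping.lookup N x"
  by (simp add: word_def count_concat_replicate keys_list in_keys_iff)

lemma set_word: "N \<in> exponents \<Longrightarrow> set (word N) = Poly_Mapping.keys N"
  using count_word[of N] by (metis (mono_tags, lifting) count_eq_zero_iff in_keys_iff set_mset_mset subsetI subset_antisym)

lemma set_word_subset: "N \<in> exponents \<Longrightarrow> set (word N) \<subseteq> B"
  by (simp add: set_word) (simp add: exponents_def)

lemma mset_word_eq_iff: "N \<in> exponents \<Longrightarrow> N' \<in> exponents \<Longrightarrow> mset (word N) = mset (word N') \<longleftrightarrow> N = N'"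
  by (metis count_word poly_mapping_eqI)

lemma ex_word: "set xs \<subseteq> B \<Longrightarrow> \<exists>N\<in>exponents. mset (word N) = mset xs"
proof -
  assume xs: "set xs \<subseteq> B"
  define N where "N = Abs_poly_mapping (count (mset xs))"
  have "{x. count (mset xs) x \<noteq> 0} = set xs" by (auto simp: count_eq_zero_iff)
  then have N: "Poly_Mapping.lookup N = count (mset xs)"
    by (simp add: N_def)
  have "N \<in> exponents" using xs by (auto simp: exponents_def in_keys_iff N count_eq_zero_iff)
  moreover from this have "mset (word N) = mset xs" by (intro multiset_eqI) (simp add: count_word N)
  ultimately show ?thesis by blast
qed

lemma P_replicate: "P (replicate n x) = incl U x ^ n"
  by (induction n) auto

text \<open>Each factor agrees with its divided power up to lower filtration, and errors remain of
  lower filtration after multiplication by the other factors.\<close>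

lemma product_leading:
  assumes "distinct ks" "set ks \<subseteq> B"
  shows "prod_list (map (\<lambda>x. d x (f x)) ks) -
      ascale U (1 / of_nat (\<Prod>x\<leftarrow>ks. fact (f x))) (P (concat (map (\<lambda>x. replicate (f x) x) ks)))
      \<in> Fil (length (concat (map (\<lambda>x. replicate (f x) x) ks)))"
    (is "?M ks - ascale U (1 / of_nat (?p ks)) (P (?w ks)) \<in> Fil (length (?w ks))")
  using assms
proof (induction ks)
  case (Cons x ks)
  define n m where "n = f x" and "m = length (?w ks)"
  define u' v' where "u' = divpow U (incl U x) n" and "v' = ascale U (1 / of_nat (?p ks)) (P (?w ks))"
  have u: "d x n - u' \<in> Fil n" using d_leading Cons.prems by (simp add: u'_def)
  have v: "?M ks - v' \<in> Fil m" using Cons by (simp add: v'_def m_def)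
  have u': "u' \<in> Fil (Suc n)"
    using P_in_Fil[of "replicate n x" "Suc n"] by (simp add: u'_def divpow_def P_replicate Fil_scale)
  have "v' \<in> Fil (Suc m)" by (simp add: v'_def m_def Fil_scale P_in_Fil)
  then have "(?M ks - v') + v' \<in> Fil (Suc m)"
    using v Fil_mono[of m "Suc m"] by (intro Fil_add) auto
  then have "(d x n - u') * ?M ks \<in> Fil (n + m)" using Fil_mult[OF u, of "?M ks" "Suc m"] by simp
  moreover have "u' * (?M ks - v') \<in> Fil (n + m)" using Fil_mult[OF u' v] by simp
  moreover have "d x n * ?M ks - u' * v' = (d x n - u') * ?M ks + u' * (?M ks - v')"
    by (simp add: algebra_simps)
  ultimately have "d x n * ?M ks - u' * v' \<in> Fil (n + m)" by (simp add: Fil_add)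
  moreover have "u' * v' = ascale U (1 / of_nat (?p (x # ks))) (P (?w (x # ks)))"
    by (simp add: u'_def v'_def divpow_def A.scale_mult_left A.scale_mult_right P_replicate n_def)
  ultimately show ?case by (simp add: n_def m_def)
qed (simp add: Fil_zero)

lemma monomial_leading:
  assumes "N \<in> exponents"
  shows "monomial r d N - ascale U (1 / of_nat (mfact (mset (word N)))) (P (word N)) \<in> Fil (length (word N))"
proof -
  let ?ks = "ordered_list r (Poly_Mapping.keys N)"
  have "mfact (mset (word N)) = (\<Prod>x\<in>set ?ks. fact (Poly_Mapping.lookup N x))"
    using assms by (simp add: mfact_def count_word set_word keys_list)
  also have "\<dots> = (\<Prod>x\<leftarrow>?ks. fact (Poly_Mapping.lookup N x))"
    using keys_list(1)[OF assms] by (rule prod.distinct_set_conv_list)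
  finally have *: "mfact (mset (word N)) = (\<Prod>x\<leftarrow>?ks. fact (Poly_Mapping.lookup N x))" .
  have "set ?ks \<subseteq> B" using keys_list[OF assms] assms by (simp add: exponents_def)
  from product_leading[OF keys_list(1)[OF assms] this, of "Poly_Mapping.lookup N"]
  show ?thesis unfolding * by (simp only: monomial_def word_def)
qed

lemma monomial_UZ:
  assumes "N \<in> exponents"
  shows "monomial r d N \<in> UZ"
proof -
  have "prod_list (map (\<lambda>x. d x (f x)) ks) \<in> UZ" if "set ks \<subseteq> B" for ks and f :: "'g \<Rightarrow> nat"
    using that by (induction ks) (auto intro: int_env.intros d_UZ)
  then show ?thesis using keys_list[OF assms] assms by (simp add: monomial_def exponents_def)
qed

lemma span_B: "L.span B = UNIV"
proof -
  have "zmod.span B \<subseteq> L.span B"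
  proof
    fix x assume "x \<in> zmod.span B"
    then show "x \<in> L.span B"
      by (induction rule: zmod.span_induct_alt)
        (auto simp: zmul_lie intro: L.span_zero L.span_add L.span_scale L.span_base)
  qed
  then have "L.span gZ \<subseteq> L.span B" using basis by (simp add: Z_basis_def L.span_minimal)
  then show ?thesis by (simp add: span_gZ top.extremum_unique)
qed

section \<open>Coefficient functionals of the monomials\<close>

definition dual_family :: "('g \<Rightarrow> 'u \<Rightarrow> complex) \<Rightarrow> bool" where
  "dual_family l \<longleftrightarrow> (\<forall>b. functional (l b)) \<and> (\<forall>b. l b 1 = 0) \<and>
    (\<forall>b\<in>B. \<forall>c\<in>B. l b (incl U c) = of_bool (c = b))"

lemma functional_coefficient: "dual_family l \<Longrightarrow> functional (conv_list l bs)"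
  by (simp add: dual_family_def functional_conv_list)

lemma coefficient_P:
  assumes "dual_family l" "set bs \<subseteq> B" "set xs \<subseteq> B" "length xs \<le> length bs"
  shows "conv_list l bs (P xs) = of_bool (mset xs = mset bs) * of_nat (mfact (mset bs))"
  using assms by (intro conv_list_prod_list) (auto simp: dual_family_def)

lemma coefficient_Fil:
  assumes l: "dual_family l" and bs: "set bs \<subseteq> B" and u: "u \<in> Fil (length bs)"
  shows "conv_list l bs u = 0"
  using u unfolding Fil_span[OF span_B]
proof (induction rule: A.span_induct_alt)
  case base
  then show ?case using functional_coefficient[OF l] by (simp add: additive.zero functional_additive)
next
  case (step c x y)
  then obtain xs where xs: "x = P xs" "length xs < length bs" "set xs \<subseteq> B" by auto
  then have "mset xs \<noteq> mset bs" using mset_eq_length by (metis nat_neq_iff)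
  then have "conv_list l bs x = 0" using coefficient_P[OF l bs xs(3)] xs by simp
  then show ?case using step functional_coefficient[OF l] by (simp add: functional_def)
qed

text \<open>The denominator \<open>mfact\<close> of the leading term cancels the permanent, and the
  lower terms have too few factors to be seen.\<close>

lemma coefficient_monomial:
  assumes l: "dual_family l" and N: "N \<in> exponents" "N' \<in> exponents" "length (word N') \<le> length (word N)"
  shows "conv_list l (word N) (monomial r d N') = of_bool (N' = N)"
proof -
  let ?\<Lambda> = "conv_list l (word N)" and ?p = "ascale U (1 / of_nat (mfact (mset (word N')))) (P (word N'))"
  have "monomial r d N' - ?p \<in> Fil (length (word N))"
    using monomial_leading[OF N(2)] Fil_mono[OF N(3)] by blast
  then have "?\<Lambda> (monomial r d N' - ?p) = 0"
    using coefficient_Fil[OF l set_word_subset[OF N(1)]] by simp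
  then have "?\<Lambda> (monomial r d N') = ?\<Lambda> ?p"
    using functional_coefficient[OF l] by (simp add: additive.diff functional_additive)
  also have "\<dots> = 1 / of_nat (mfact (mset (word N'))) * ?\<Lambda> (P (word N'))"
    using functional_coefficient[OF l] by (simp only: functional_scale)
  also have "\<dots> = of_bool (N' = N)"
    using coefficient_P[OF l set_word_subset[OF N(1)] set_word_subset[OF N(2)] N(3)] mfact_pos[of "mset (word N)"]
    by (auto simp: mset_word_eq_iff N)
  finally show ?thesis .
qed

lemma ex_dual_family:
  assumes "finite F" "F \<subseteq> UZ"
  obtains l where "dual_family l" "\<And>b. l b ` F \<subseteq> \<int>"
  using dual_functionals[OF basis assms] unfolding dual_family_def by metis

section \<open>Injectivity and independence of the monomials\<close>

lemma inj_on_monomial: "inj_on (monomial r d) exponents"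
proof -
  obtain l where l: "dual_family l" using ex_dual_family[of "{}"] by auto
  \<comment> \<open>The functional of the longer word takes the value 1 at its own monomial, hence
    also at the equal one.\<close>
  have "N' = N" if "N \<in> exponents" "N' \<in> exponents" "monomial r d N = monomial r d N'"
    "length (word N') \<le> length (word N)" for N N'
    using coefficient_monomial[OF l that(1,2,4)] coefficient_monomial[OF l that(1,1)] that(3)
    by (simp split: if_splits)
  then show ?thesis by (metis inj_onI linorder_le_cases)
qed

lemma independent_monomials: "\<not> zmod.dependent (monomial r d ` exponents)"
  unfolding zmod.independent_explicit_module
proof (intro allI impI)
  fix t k v
  assume t: "finite t" "t \<subseteq> monomial r d ` exponents" "(\<Sum>v\<in>t. zmul (k v) v) = 0" "v \<in> t"
  obtain l where l: "dual_family l" using ex_dual_family[of "{}"] by auto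
  have "\<forall>v\<in>t. \<exists>N. N \<in> exponents \<and> v = monomial r d N" using t(2) by blast
  then obtain e where e: "\<And>v. v \<in> t \<Longrightarrow> e v \<in> exponents \<and> v = monomial r d (e v)"
    using bchoice by meson
  define t0 where "t0 = {v \<in> t. k v \<noteq> 0}"
  have "t0 = {}"
  proof (rule ccontr)
    let ?g = "\<lambda>v. length (word (e v))"
    assume "t0 \<noteq> {}"
    moreover have fin: "finite t0" using t(1) by (simp add: t0_def)
    ultimately have "Max (?g ` t0) \<in> ?g ` t0" by simp
    \<comment> \<open>For a longest monomial in the support, the functional of its word vanishes at
      all the others, since none of them is longer.\<close>
    then obtain w where w: "w \<in> t0" "?g w = Max (?g ` t0)" by auto
    have max: "?g v \<le> ?g w" if "v \<in> t0" for v using that fin w(2) by simp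
    let ?\<Lambda> = "conv_list l (word (e w))"
    note lin = functional_coefficient[OF l, of "word (e w)"]
    have "(\<Sum>v\<in>t. zmul (k v) v) = (\<Sum>v\<in>t0. zmul (k v) v)"
      using t(1) by (intro sum.mono_neutral_right) (auto simp: t0_def)
    then have "0 = ?\<Lambda> (\<Sum>v\<in>t0. zmul (k v) v)"
      using lin t(3) by (simp add: additive.zero functional_additive)
    also have "\<dots> = (\<Sum>v\<in>t0. of_int (k v) * ?\<Lambda> v)"
      using lin by (simp add: additive.sum functional_additive functional_zmul)
    also have "\<dots> = (\<Sum>v\<in>t0. if v = w then of_int (k v) else 0)"
    proof (rule sum.cong)
      fix v assume v: "v \<in> t0"
      have vt: "v \<in> t" "w \<in> t" using v w by (auto simp: t0_def)
      have "?\<Lambda> (monomial r d (e v)) = of_bool (e v = e w)"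
        using coefficient_monomial[OF l, of "e w" "e v"] e[OF vt(1)] e[OF vt(2)] max[OF v] by simp
      moreover have "e v = e w \<longleftrightarrow> v = w" using e[OF vt(1)] e[OF vt(2)] by metis
      moreover have "monomial r d (e v) = v" using e[OF vt(1)] by simp
      ultimately show "of_int (k v) * ?\<Lambda> v = (if v = w then of_int (k v) else 0)" by simp
    qed simp
    also have "\<dots> = of_int (k w)" using w fin by simp
    finally show False using w by (simp add: t0_def)
  qed
  then show "k v = 0" using t(4) by (auto simp: t0_def)
qed

section \<open>Generation of the integral form\<close>

lemma Fil_Suc_subset:
  "Fil (Suc n) \<subseteq> A.span (monomial r d ` {N \<in> exponents. length (word N) = n} \<union> Fil n)"
    (is "_ \<subseteq> ?S")
  unfolding Fil_span[OF span_B, of "Suc n"]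
proof (rule A.span_minimal)
  show "{P ys | ys. length ys < Suc n \<and> set ys \<subseteq> B} \<subseteq> ?S"
  proof safe
    fix xs assume xs: "length xs < Suc n" "set xs \<subseteq> B"
    have Fil: "u \<in> ?S" if "u \<in> Fil n" for u using that by (simp add: A.span_base)
    show "P xs \<in> ?S"
    proof (cases "length xs = n")
      case True
      obtain N where N: "N \<in> exponents" "mset (word N) = mset xs" using ex_word[OF xs(2)] by blast
      then have len: "length (word N) = n" using True mset_eq_length by metis
      let ?m = "of_nat (mfact (mset (word N))) :: complex"
      have "?m \<noteq> 0" using mfact_pos[of "mset (word N)"] by simp
      \<comment> \<open>Up to shorter products, \<open>P xs\<close> may be sorted into
        \<open>P (word N)\<close>, which is \<open>?m\<close> times the monomial up to shorter
        products.\<close>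
      then have eq: "P xs = (P xs - P (word N)) + ascale U ?m (monomial r d N)
          - ascale U ?m (monomial r d N - ascale U (1 / ?m) (P (word N)))"
        by (simp add: A.scale_right_diff_distrib)
      have 1: "P xs - P (word N) \<in> ?S" using P_mset_eq[of xs "word N"] N True by (simp add: Fil)
      have 2: "monomial r d N - ascale U (1 / ?m) (P (word N)) \<in> ?S"
        using monomial_leading[OF N(1)] len by (simp add: Fil)
      have 3: "monomial r d N \<in> ?S" using N len by (intro A.span_base) auto
      from A.span_diff[OF A.span_add[OF 1 A.span_scale[OF 3, of ?m]] A.span_scale[OF 2, of ?m]]
      show ?thesis by (simp only: eq[symmetric])
    next
      case False
      then show ?thesis using xs by (intro Fil P_in_Fil) simp
    qed
  qed
qed simp

text \<open>The top layer of \<open>u\<close> is a complex combination of monomials with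
  \<open>n\<close> factors. Its coefficients turn out to be integers, so subtracting it leaves an
  integral element of smaller filtration.\<close>

lemma UZ_Fil_subset: "u \<in> UZ \<Longrightarrow> u \<in> Fil n \<Longrightarrow> u \<in> zmod.span (monomial r d ` exponents)"
proof (induction n arbitrary: u)
  case 0
  then show ?case by (simp add: Fil_0 zmod.span_zero)
next
  case (Suc n)
  have "u \<in> A.span (monomial r d ` {N \<in> exponents. length (word N) = n} \<union> Fil n)"
    using Suc.prems Fil_Suc_subset by blast
  then obtain x w where xw: "u = x + w" "x \<in> A.span (monomial r d ` {N \<in> exponents. length (word N) = n})"
      and "w \<in> A.span (Fil n)"
    by (auto simp: A.span_Un)
  then have w: "w \<in> Fil n" using subspace_Fil by (metis A.span_eq_iff)
  obtain t c where t: "finite t" "t \<subseteq> monomial r d ` {N \<in> exponents. length (word N) = n}"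
      "x = (\<Sum>v\<in>t. ascale U (c v) v)"
    using xw(2) by (auto simp: A.span_explicit)
  have "c v \<in> \<int>" if "v \<in> t" for v
  proof -
    obtain N where N: "v = monomial r d N" "N \<in> exponents" "length (word N) = n" using t(2) \<open>v \<in> t\<close> by auto
    \<comment> \<open>The finite set depends on \<open>u\<close> and on the word; the dual family is
      then chosen integral on it, which makes the coefficient functional integral at
      \<open>u\<close>.\<close>
    obtain F where F: "finite F" "F \<subseteq> UZ"
        "\<And>l. \<forall>b. functional (l b) \<Longrightarrow> \<forall>b. l b ` F \<subseteq> \<int> \<Longrightarrow> conv_list l (word N) u \<in> \<int>"
      using conv_list_integral[OF Suc.prems(1)] by metis
    obtain l where l: "dual_family l" "\<And>b. l b ` F \<subseteq> \<int>" using ex_dual_family[OF F(1,2)] by metis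
    note lin = functional_coefficient[OF l(1), of "word N"]
    \<comment> \<open>The part \<open>w\<close> contributes nothing, having fewer than
      \<open>n\<close> factors; duality then isolates \<open>c v\<close>.\<close>
    have "conv_list l (word N) u = (\<Sum>v'\<in>t. c v' * conv_list l (word N) v')"
      using lin coefficient_Fil[OF l(1) set_word_subset[OF N(2)]] w N(3)
      by (simp add: xw(1) t(3) additive.add additive.sum functional_additive functional_scale)
    also have "\<dots> = (\<Sum>v'\<in>t. if v' = v then c v' else 0)"
    proof (rule sum.cong)
      fix v' assume "v' \<in> t"
      then obtain N' where N': "v' = monomial r d N'" "N' \<in> exponents" "length (word N') = n" using t(2) by auto
      then have "v' = v \<longleftrightarrow> N' = N" using N inj_on_monomial by (auto dest: inj_onD)
      then show "c v' * conv_list l (word N) v' = (if v' = v then c v' else 0)"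
        using coefficient_monomial[OF l(1) N(2) N'(2)] N N' by simp
    qed simp
    also have "\<dots> = c v" using t(1) that by simp
    finally show ?thesis using F(3)[of l] l by (simp add: dual_family_def)
  qed
  then have "\<forall>v\<in>t. \<exists>j. c v = of_int j" by (auto elim: Ints_cases)
  then obtain k where k: "\<And>v. v \<in> t \<Longrightarrow> c v = of_int (k v)" using bchoice by meson
  have "x = (\<Sum>v\<in>t. zmul (k v) v)" by (simp add: t(3) zmul_env k cong: sum.cong)
  then have x: "x \<in> zmod.span (monomial r d ` exponents)"
    using t(2) by (auto intro!: zmod.span_sum zmod.span_scale intro: zmod.span_base)
  have "zmod.span (monomial r d ` exponents) \<subseteq> UZ"
    using monomial_UZ subspace_UZ by (intro zmod.span_minimal) auto
  \<comment> \<open>As \<open>x\<close> is now known to be integral, the remainder \<open>w\<close>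
    lies in \<open>UZ\<close> and the induction hypothesis applies to it.\<close>
  then have "u - x \<in> UZ" using x Suc.prems by (auto intro: int_env.intros)
  then have "w \<in> zmod.span (monomial r d ` exponents)" using Suc.IH w xw(1) by simp
  then show ?case using x xw(1) by (simp add: zmod.span_add)
qed

lemma span_monomials: "zmod.span (monomial r d ` exponents) = UZ"
proof (rule antisym)
  show "zmod.span (monomial r d ` exponents) \<subseteq> UZ"
    using monomial_UZ subspace_UZ by (intro zmod.span_minimal) auto
  show "UZ \<subseteq> zmod.span (monomial r d ` exponents)"
    using UZ_Fil_subset ex_Fil by blast
qed

end

theorem mainTheorem4:
  fixes S :: "('i, 'y::ab_group_add) root_data"
    and G :: "('i, 'y, 'g::ab_group_add) km_data"
    and U :: "('g, 'u::ring_1) env_data"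
    and b :: "'i root_lattice \<Rightarrow> 'g set"
    and B :: "'g set"
    and r :: "('g \<times> 'g) set"
    and d :: "'g \<Rightarrow> nat \<Rightarrow> 'u"
  assumes "root_generating_system S"
    and "kac_moody_algebra S G"
    and "enveloping_algebra G U"
    and "adapted_basis S G U b B"
    and "linear_order_on B r"
    and "divided_powers S G U b d"
  shows "inj_on (monomial r d) {N. Poly_Mapping.keys N \<subseteq> B} \<and>
    Z_basis (monomial r d ` {N. Poly_Mapping.keys N \<subseteq> B}) (int_env S G U)"
proof -
  interpret km_monomials S G U B r d
  proof
    show "Z_basis B (int_lie S G U)" using assms(4)[unfolded adapted_basis_def] by blast
    show "d x n \<in> int_env S G U" "d x n - divpow U (incl U x) n \<in> filtration_less U n"
      if "x \<in> B" for x n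
    proof -
      have "x \<in> (\<Union>\<alpha>\<in>roots S G \<union> {0}. b \<alpha>)"
        using that assms(4)[unfolded adapted_basis_def] by blast
      then obtain \<alpha> where "\<alpha> \<in> roots S G \<union> {0}" "x \<in> b \<alpha>" by blast
      then show "d x n \<in> int_env S G U" "d x n - divpow U (incl U x) n \<in> filtration_less U n"
        using assms(6) unfolding divided_powers_def int_env_degree_def by blast+
    qed
  qed (use assms in simp_all)
  show ?thesis
    using inj_on_monomial independent_monomials span_monomials
    unfolding exponents_def Z_basis_def by blast
qed

end
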